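(* Let $\mathcal{S}\subseteq B(H)$, $\mathcal{T}\subseteq B(K)$ be $w^*$-closed operator systems ($H,K$ Hilbert spaces) which are TRO-equivalent as dual operator systems. Then there exist a cardinal $J$ and a unitary operator $U\in B(H\otimes\ell^2_J,K\otimes\ell^2_J)$ such that $$\mathcal{T}\bar\otimes M_J=U(\mathcal{S}\bar\otimes M_J)U^*.$$
   Context: An operator system in $B(H)$ is a norm-closed self-adjoint subspace containing $I_H$. A ternary ring of operators (TRO) is a subspace $\mathcal{M}\subseteq B(H,K)$ with $\mathcal{M}\mathcal{M}^*\mathcal{M}\subseteq\mathcal{M}$. $[\,\cdot\,]^{-w^*}$ denotes $w^*$-closed linear span. Two $w^*$-closed operator systems $\mathcal{S}\subseteq B(H)$, $\mathcal{T}\subseteq B(K)$ are TRO-equivalent (as dual operator systems) if there is a single TRO $\mathcal{M}\subseteq B(H,K)$ with $[\mathcal{M}\mathcal{S}\mathcal{M}^*]^{-w^*}=\mathcal{T}$ and $[\mathcal{M}^*\mathcal{T}\mathcal{M}]^{-w^*}=\mathcal{S}$. For a cardinal $J$, $\ell^2_J$ is the Hilbert space of square-summable families indexed by $J$, $M_J=B(\ell^2_J)$, and $\mathcal{S}\bar\otimes M_J$ is the $w^*$-closed linear span in $B(H\otimes\ell^2_J)$ of the operators $s\otimes a$, $s\in\mathcal{S}$, $a\in M_J$. *)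

theory Defs
  imports "HOL-Analysis.Analysis"
begin

text \<open>The complex inner product is linear in its first argument; its real part is the
  inner product of the underlying real Hilbert space, which supplies norm and topology.\<close>

class chilbert_space = real_inner + complete_space +
  fixes scaleC :: "complex \<Rightarrow> 'a \<Rightarrow> 'a"  (infixr "*\<^sub>C" 75)
    and cinner :: "'a \<Rightarrow> 'a \<Rightarrow> complex"
  assumes scaleC_add_right: "a *\<^sub>C (x + y) = a *\<^sub>C x + a *\<^sub>C y"
    and scaleC_add_left: "(a + b) *\<^sub>C x = a *\<^sub>C x + b *\<^sub>C x"
    and scaleC_scaleC: "a *\<^sub>C (b *\<^sub>C x) = (a * b) *\<^sub>C x"
    and scaleC_of_real: "complex_of_real r *\<^sub>C x = r *\<^sub>R x"
    and cinner_commute: "cinner x y = cnj (cinner y x)"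
    and cinner_add_left: "cinner (x + y) z = cinner x z + cinner y z"
    and cinner_scaleC_left: "cinner (a *\<^sub>C x) y = a * cinner x y"
    and Re_cinner: "Re (cinner x y) = inner x y"

lemma cinner_self: "cinner x x = complex_of_real ((norm x)\<^sup>2)"
proof -
  have "Im (cinner x x) = 0"
    using arg_cong[OF cinner_commute[of x x], of Im] by simp
  then show ?thesis
    by (simp add: complex_eq_iff Re_cinner dot_square_norm)
qed

lemma cinner_add_right: "cinner x (y + z) = cinner x y + cinner x z"
  by (metis cinner_add_left cinner_commute complex_cnj_add)

lemma cinner_scaleC_right: "cinner x (a *\<^sub>C y) = cnj a * cinner x y"
  by (metis cinner_commute cinner_scaleC_left complex_cnj_mult)

lemma cinner_scaleR_left: "cinner (r *\<^sub>R x) y = complex_of_real r * cinner x y"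
  by (metis cinner_scaleC_left scaleC_of_real)

lemma scaleC_scaleR_commute: "a *\<^sub>C (r *\<^sub>R x) = r *\<^sub>R (a *\<^sub>C x)"
  by (metis mult.commute scaleC_of_real scaleC_scaleC)

lemma norm_scaleC: "norm (a *\<^sub>C x) = cmod a * norm x"
proof -
  have "cinner (a *\<^sub>C x) (a *\<^sub>C x) = (a * cnj a) * cinner x x"
    by (simp add: cinner_scaleC_left cinner_scaleC_right)
  also have "\<dots> = complex_of_real ((cmod a * norm x)\<^sup>2)"
    by (simp only: complex_norm_square[symmetric] cinner_self power_mult_distrib of_real_mult)
  finally have "(norm (a *\<^sub>C x))\<^sup>2 = (cmod a * norm x)\<^sup>2"
    by (simp only: cinner_self of_real_eq_iff)
  then show ?thesis
    by (simp add: power2_eq_iff_nonneg)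
qed

lemma norm_cinner_le: "cmod (cinner x y) \<le> norm x * norm y"
proof (cases "cinner x y = 0")
  case False
  define c where "c = cnj (sgn (cinner x y))"
  have c1: "cmod c = 1"
    using False by (simp add: c_def norm_sgn)
  have "cinner (c *\<^sub>C x) y = complex_of_real (cmod (cinner x y))"
  proof -
    have "cnj (sgn z) * z = complex_of_real (cmod z)" if "z \<noteq> 0" for z
    proof -
      have "cnj (sgn z) * z = z * cnj z / complex_of_real (cmod z)"
        by (simp add: sgn_eq mult.commute)
      also have "\<dots> = complex_of_real (cmod z)"
        using that by (simp add: complex_norm_square[symmetric] power2_eq_square)
      finally show ?thesis .
    qed
    then show ?thesis
      using False by (simp add: c_def cinner_scaleC_left)
  qed
  then have "cmod (cinner x y) = inner (c *\<^sub>C x) y"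
    by (metis Re_cinner Re_complex_of_real)
  also have "\<dots> \<le> norm (c *\<^sub>C x) * norm y"
    by (rule norm_cauchy_schwarz)
  finally show ?thesis
    by (simp add: norm_scaleC c1)
qed simp

instantiation complex :: chilbert_space
begin

definition scaleC_complex :: "complex \<Rightarrow> complex \<Rightarrow> complex" where
  "scaleC_complex a x = a * x"

definition cinner_complex :: "complex \<Rightarrow> complex \<Rightarrow> complex" where
  "cinner_complex x y = x * cnj y"

instance
  by standard
    (auto simp: scaleC_complex_def cinner_complex_def algebra_simps scaleR_conv_of_real
      inner_complex_def)

end

typedef (overloaded) ('j, 'a) ell2 =
  "{f :: 'j \<Rightarrow> 'a::chilbert_space. (\<lambda>j. (norm (f j))\<^sup>2) summable_on UNIV}"
  morphisms ell2_nth Abs_ell2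
  by (rule exI[of _ "\<lambda>_. 0"]) simp

lemma ell2_summable: "(\<lambda>j. (norm (ell2_nth f j))\<^sup>2) summable_on UNIV"
  using ell2_nth[of f] by simp

lemma ell2_eqI: "(\<And>j. ell2_nth f j = ell2_nth g j) \<Longrightarrow> f = g"
  by (metis ell2_nth_inject ext)

lemma square_summable_add:
  fixes f g :: "'j \<Rightarrow> 'a::chilbert_space"
  assumes f: "(\<lambda>j. (norm (f j))\<^sup>2) summable_on UNIV" and g: "(\<lambda>j. (norm (g j))\<^sup>2) summable_on UNIV"
  shows "(\<lambda>j. (norm (f j + g j))\<^sup>2) summable_on UNIV"
proof (rule summable_on_comparison_test)
  show "(\<lambda>j. 2 * (norm (f j))\<^sup>2 + 2 * (norm (g j))\<^sup>2) summable_on UNIV"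
    by (intro summable_on_add summable_on_cmult_right f g)
  fix j
  have "(norm (f j + g j))\<^sup>2 \<le> (norm (f j) + norm (g j))\<^sup>2"
    by (intro power_mono norm_triangle_ineq) simp
  also have "\<dots> \<le> 2 * (norm (f j))\<^sup>2 + 2 * (norm (g j))\<^sup>2"
    using sum_squares_bound[of "norm (f j)" "norm (g j)"] by (simp add: power2_sum)
  finally show "(norm (f j + g j))\<^sup>2 \<le> 2 * (norm (f j))\<^sup>2 + 2 * (norm (g j))\<^sup>2" .
qed simp

lemma square_summable_scaleC:
  fixes f :: "'j \<Rightarrow> 'a::chilbert_space"
  assumes f: "(\<lambda>j. (norm (f j))\<^sup>2) summable_on UNIV"
  shows "(\<lambda>j. (norm (a *\<^sub>C f j))\<^sup>2) summable_on UNIV"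
  using summable_on_cmult_right[OF f] by (simp add: norm_scaleC power_mult_distrib)

lemma cinner_abs_summable:
  fixes f g :: "'j \<Rightarrow> 'a::chilbert_space"
  assumes f: "(\<lambda>j. (norm (f j))\<^sup>2) summable_on UNIV" and g: "(\<lambda>j. (norm (g j))\<^sup>2) summable_on UNIV"
  shows "(\<lambda>j. norm (cinner (f j) (g j))) summable_on UNIV"
proof (rule summable_on_comparison_test)
  show "(\<lambda>j. (norm (f j))\<^sup>2 + (norm (g j))\<^sup>2) summable_on UNIV"
    by (intro summable_on_add f g)
  fix j
  have "norm (cinner (f j) (g j)) \<le> norm (f j) * norm (g j)"
    by (rule norm_cinner_le)
  also have "\<dots> \<le> (norm (f j))\<^sup>2 + (norm (g j))\<^sup>2"
    using sum_squares_bound[of "norm (f j)" "norm (g j)"]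
      mult_nonneg_nonneg[OF norm_ge_zero[of "f j"] norm_ge_zero[of "g j"]] by linarith
  finally show "norm (cinner (f j) (g j)) \<le> (norm (f j))\<^sup>2 + (norm (g j))\<^sup>2" .
qed simp

lemma ell2_cinner_summable:
  "(\<lambda>j. cinner (ell2_nth f j) (ell2_nth g j)) summable_on UNIV"
  by (rule abs_summable_summable[OF cinner_abs_summable[OF ell2_summable ell2_summable]])

lemma ell2_inner_summable:
  "(\<lambda>j. inner (ell2_nth f j) (ell2_nth g j)) summable_on UNIV"
  using summable_on_Re[OF ell2_cinner_summable[of f g]] by (simp add: Re_cinner)

instantiation ell2 :: (type, chilbert_space) real_inner
begin

definition zero_ell2 :: "('a, 'b) ell2" where
  "zero_ell2 = Abs_ell2 (\<lambda>_. 0)"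

definition plus_ell2 :: "('a, 'b) ell2 \<Rightarrow> ('a, 'b) ell2 \<Rightarrow> ('a, 'b) ell2" where
  "plus_ell2 f g = Abs_ell2 (\<lambda>j. ell2_nth f j + ell2_nth g j)"

definition scaleR_ell2 :: "real \<Rightarrow> ('a, 'b) ell2 \<Rightarrow> ('a, 'b) ell2" where
  "scaleR_ell2 r f = Abs_ell2 (\<lambda>j. r *\<^sub>R ell2_nth f j)"

definition uminus_ell2 :: "('a, 'b) ell2 \<Rightarrow> ('a, 'b) ell2" where
  "uminus_ell2 f = scaleR (- 1) f"

definition minus_ell2 :: "('a, 'b) ell2 \<Rightarrow> ('a, 'b) ell2 \<Rightarrow> ('a, 'b) ell2" where
  "minus_ell2 f g = f + (- g)"

definition inner_ell2 :: "('a, 'b) ell2 \<Rightarrow> ('a, 'b) ell2 \<Rightarrow> real" where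
  "inner_ell2 f g = (\<Sum>\<^sub>\<infinity>j. inner (ell2_nth f j) (ell2_nth g j))"

definition norm_ell2 :: "('a, 'b) ell2 \<Rightarrow> real" where
  "norm_ell2 f = sqrt (inner f f)"

definition sgn_ell2 :: "('a, 'b) ell2 \<Rightarrow> ('a, 'b) ell2" where
  "sgn_ell2 f = scaleR (inverse (norm f)) f"

definition dist_ell2 :: "('a, 'b) ell2 \<Rightarrow> ('a, 'b) ell2 \<Rightarrow> real" where
  "dist_ell2 f g = norm (f - g)"

definition uniformity_ell2 :: "(('a, 'b) ell2 \<times> ('a, 'b) ell2) filter" where
  "uniformity_ell2 = (INF e\<in>{0 <..}. principal {(x, y). dist x y < e})"

definition open_ell2 :: "('a, 'b) ell2 set \<Rightarrow> bool" where
  "open_ell2 U = (\<forall>x\<in>U. eventually (\<lambda>(x', y). x' = x \<longrightarrow> y \<in> U) uniformity)"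

lemma zero_ell2_nth: "ell2_nth (0::('a, 'b) ell2) j = 0"
  unfolding zero_ell2_def by (subst Abs_ell2_inverse) simp_all

lemma plus_ell2_nth: "ell2_nth (f + g) j = ell2_nth f j + ell2_nth g j"
  for f :: "('a, 'b) ell2"
  unfolding plus_ell2_def
  by (subst Abs_ell2_inverse) (simp_all add: square_summable_add ell2_summable)

lemma scaleR_ell2_nth: "ell2_nth (scaleR r f) j = r *\<^sub>R ell2_nth f j"
  for f :: "('a, 'b) ell2"
  unfolding scaleR_ell2_def
  by (subst Abs_ell2_inverse)
    (use square_summable_scaleC[OF ell2_summable[of f], of "complex_of_real r"]
      in \<open>simp_all add: scaleC_of_real\<close>)

lemma uminus_ell2_nth: "ell2_nth (- f) j = - ell2_nth f j"
  for f :: "('a, 'b) ell2"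
  by (simp add: uminus_ell2_def scaleR_ell2_nth)

lemma minus_ell2_nth: "ell2_nth (f - g) j = ell2_nth f j - ell2_nth g j"
  for f :: "('a, 'b) ell2"
  by (simp add: minus_ell2_def plus_ell2_nth uminus_ell2_nth)

lemmas ell2_nth_simps = zero_ell2_nth plus_ell2_nth scaleR_ell2_nth
  uminus_ell2_nth minus_ell2_nth

instance
proof
  fix x y z :: "('a, 'b) ell2" and r s :: real
  show "x + y + z = x + (y + z)" "x + y = y + x" "0 + x = x" "- x + x = 0" "x - y = x + - y"
    by (rule ell2_eqI, simp add: ell2_nth_simps)+
  show "scaleR r (x + y) = scaleR r x + scaleR r y"
    "scaleR (r + s) x = scaleR r x + scaleR s x"
    "scaleR r (scaleR s x) = scaleR (r * s) x" "scaleR 1 x = x"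
    by (rule ell2_eqI, simp add: ell2_nth_simps algebra_simps)+
  show "sgn x = scaleR (inverse (norm x)) x" by (rule sgn_ell2_def)
  show "dist x y = norm (x - y)" by (rule dist_ell2_def)
  show "(uniformity :: (('a, 'b) ell2 \<times> ('a, 'b) ell2) filter)
      = (INF e\<in>{0 <..}. principal {(x, y). dist x y < e})"
    by (rule uniformity_ell2_def)
  show "open U = (\<forall>x\<in>U. eventually (\<lambda>(x', y). x' = x \<longrightarrow> y \<in> U) uniformity)"
    for U :: "('a, 'b) ell2 set"
    by (rule open_ell2_def)
  show "inner x y = inner y x"
    by (simp add: inner_ell2_def inner_commute)
  show "inner (x + y) z = inner x z + inner y z"
    by (simp add: inner_ell2_def ell2_nth_simps inner_add_left infsum_add ell2_inner_summable)
  show "inner (scaleR r x) y = r * inner x y"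
    by (simp add: inner_ell2_def ell2_nth_simps infsum_cmult_right')
  show "0 \<le> inner x x"
    by (simp add: inner_ell2_def infsum_nonneg)
  show "norm x = sqrt (inner x x)"
    by (rule norm_ell2_def)
  show "inner x x = 0 \<longleftrightarrow> x = 0"
  proof
    assume *: "inner x x = 0"
    have "inner (ell2_nth x j) (ell2_nth x j) = 0" for j
      using * nonneg_infsum_le_0D[of "\<lambda>j. inner (ell2_nth x j) (ell2_nth x j)" UNIV j]
      by (simp add: inner_ell2_def ell2_inner_summable)
    then show "x = 0"
      by (intro ell2_eqI) (simp add: zero_ell2_nth)
  qed (simp add: inner_ell2_def zero_ell2_nth)
qed

end

lemma norm_ell2_square: "(norm f)\<^sup>2 = (\<Sum>\<^sub>\<infinity>j. (norm (ell2_nth f j))\<^sup>2)"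
  unfolding dot_square_norm[symmetric] inner_ell2_def by (rule refl)

lemma ell2_finite_sum_le: "finite F \<Longrightarrow> (\<Sum>j\<in>F. (norm (ell2_nth f j))\<^sup>2) \<le> (norm f)\<^sup>2"
  unfolding norm_ell2_square by (rule finite_sum_le_infsum[OF ell2_summable]) auto

lemma norm_ell2_nth_le: "norm (ell2_nth f j) \<le> norm f" for f :: "('a, 'b::chilbert_space) ell2"
  using ell2_finite_sum_le[of "{j}" f] norm_ge_zero[of f]
  by (simp add: power2_le_iff_abs_le)

lemma ell2_limit:
  fixes X :: "nat \<Rightarrow> ('a, 'b::chilbert_space) ell2"
  assumes Cau: "\<And>e. e > 0 \<Longrightarrow> \<exists>N. \<forall>m\<ge>N. \<forall>n\<ge>N. norm (X m - X n) < e"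
  shows "\<exists>L. \<forall>e>0. \<exists>N. \<forall>n\<ge>N. norm (X n - L) \<le> e"
proof -
  have "\<exists>l. (\<lambda>n. ell2_nth (X n) j) \<longlonglongrightarrow> l" for j
  proof -
    have "Cauchy (\<lambda>n. ell2_nth (X n) j)"
      unfolding Cauchy_def dist_norm
    proof (intro allI impI)
      fix e :: real assume "0 < e"
      then obtain N where N: "\<forall>m\<ge>N. \<forall>n\<ge>N. norm (X m - X n) < e"
        using Cau by blast
      have "norm (ell2_nth (X m) j - ell2_nth (X n) j) < e" if "m \<ge> N" "n \<ge> N" for m n
        using norm_ell2_nth_le[of "X m - X n" j] N that
        by (simp add: minus_ell2_nth) (metis order_le_less_trans)
      then show "\<exists>N. \<forall>m\<ge>N. \<forall>n\<ge>N. norm (ell2_nth (X m) j - ell2_nth (X n) j) < e"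
        by blast
    qed
    then show ?thesis
      by (simp add: Cauchy_convergent_iff convergent_def)
  qed
  then obtain l where l: "\<And>j. (\<lambda>n. ell2_nth (X n) j) \<longlonglongrightarrow> l j"
    by metis
  have bound: "(\<Sum>j\<in>F. (norm (ell2_nth (X n) j - l j))\<^sup>2) \<le> e\<^sup>2"
    if "\<forall>m\<ge>N. \<forall>n\<ge>N. norm (X m - X n) < e" "n \<ge> N" "finite F" for N n F e
  proof (rule tendsto_upperbound)
    show "(\<lambda>m. \<Sum>j\<in>F. (norm (ell2_nth (X n) j - ell2_nth (X m) j))\<^sup>2)
      \<longlonglongrightarrow> (\<Sum>j\<in>F. (norm (ell2_nth (X n) j - l j))\<^sup>2)"
      by (intro tendsto_intros l)
    have "(\<Sum>j\<in>F. (norm (ell2_nth (X n) j - ell2_nth (X m) j))\<^sup>2) \<le> e\<^sup>2" if "m \<ge> N" for m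
    proof -
      have "(norm (X n - X m))\<^sup>2 \<le> e\<^sup>2"
        using \<open>\<forall>m\<ge>N. \<forall>n\<ge>N. norm (X m - X n) < e\<close> \<open>n \<ge> N\<close> that
        by (intro power_mono) (auto intro: less_imp_le)
      then show ?thesis
        using ell2_finite_sum_le[OF \<open>finite F\<close>, of "X n - X m"] by (simp add: minus_ell2_nth)
    qed
    then show "\<forall>\<^sub>F m in sequentially. (\<Sum>j\<in>F. (norm (ell2_nth (X n) j - ell2_nth (X m) j))\<^sup>2) \<le> e\<^sup>2"
      by (auto simp: eventually_sequentially)
  qed simp
  have summ: "(\<lambda>j. (norm (ell2_nth (X n) j - l j))\<^sup>2) summable_on UNIV"
    if "\<forall>m\<ge>N. \<forall>n\<ge>N. norm (X m - X n) < e" "n \<ge> N" for N n e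
    using bound[OF that] by (intro nonneg_bdd_above_summable_on) (auto simp: bdd_above_def)
  obtain N1 where N1: "\<forall>m\<ge>N1. \<forall>n\<ge>N1. norm (X m - X n) < 1"
    using Cau[of 1] by auto
  have "(\<lambda>j. (norm (ell2_nth (X N1) j + (-1) *\<^sub>C (ell2_nth (X N1) j - l j)))\<^sup>2) summable_on UNIV"
    by (rule square_summable_add[OF ell2_summable square_summable_scaleC[OF summ[OF N1 order_refl]]])
  moreover have "ell2_nth (X N1) j + (-1) *\<^sub>C (ell2_nth (X N1) j - l j) = l j" for j
    using scaleC_of_real[of "-1" "ell2_nth (X N1) j - l j"] by simp
  ultimately have lsum: "(\<lambda>j. (norm (l j))\<^sup>2) summable_on UNIV"
    by simp
  define L :: "('a, 'b) ell2" where "L = Abs_ell2 l"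
  have L: "ell2_nth L j = l j" for j
    unfolding L_def using lsum by (subst Abs_ell2_inverse) simp_all
  have "\<exists>N. \<forall>n\<ge>N. norm (X n - L) \<le> e" if e: "e > 0" for e
  proof -
    obtain N where N: "\<forall>m\<ge>N. \<forall>n\<ge>N. norm (X m - X n) < e"
      using Cau[OF e] by auto
    have "norm (X n - L) \<le> e" if "n \<ge> N" for n
    proof (rule power2_le_imp_le)
      show "(norm (X n - L))\<^sup>2 \<le> e\<^sup>2"
        unfolding norm_ell2_square minus_ell2_nth L
        by (rule infsum_le_finite_sums[OF summ[OF N that]]) (use bound[OF N that] in auto)
    qed (use \<open>e > 0\<close> in simp)
    then show ?thesis by blast
  qed
  then show ?thesis by blast
qed

instantiation ell2 :: (type, chilbert_space) chilbert_space
begin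

definition scaleC_ell2 :: "complex \<Rightarrow> ('a, 'b) ell2 \<Rightarrow> ('a, 'b) ell2" where
  "scaleC_ell2 a f = Abs_ell2 (\<lambda>j. a *\<^sub>C ell2_nth f j)"

definition cinner_ell2 :: "('a, 'b) ell2 \<Rightarrow> ('a, 'b) ell2 \<Rightarrow> complex" where
  "cinner_ell2 f g = (\<Sum>\<^sub>\<infinity>j. cinner (ell2_nth f j) (ell2_nth g j))"

lemma scaleC_ell2_nth: "ell2_nth (a *\<^sub>C f) j = a *\<^sub>C ell2_nth f j"
  for f :: "('a, 'b) ell2"
  unfolding scaleC_ell2_def
  by (subst Abs_ell2_inverse) (simp_all add: square_summable_scaleC ell2_summable)

instance
proof
  fix X :: "nat \<Rightarrow> ('a, 'b) ell2"
  assume "Cauchy X"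
  then have "\<exists>N. \<forall>m\<ge>N. \<forall>n\<ge>N. norm (X m - X n) < e" if "e > 0" for e
    using that unfolding Cauchy_def dist_norm by blast
  from ell2_limit[OF this] obtain L where L: "\<And>e. e > 0 \<Longrightarrow> \<exists>N. \<forall>n\<ge>N. norm (X n - L) \<le> e"
    by auto
  have "\<exists>N. \<forall>n\<ge>N. norm (X n - L) < e" if e: "e > 0" for e
  proof -
    obtain N where "\<forall>n\<ge>N. norm (X n - L) \<le> e / 2"
      using L[OF half_gt_zero[OF e]] by blast
    then have "\<forall>n\<ge>N. norm (X n - L) < e"
      using e by (auto intro: order_le_less_trans[where y = "e / 2"])
    then show ?thesis ..
  qed
  then have "X \<longlonglongrightarrow> L"
    by (simp add: LIMSEQ_def dist_norm)
  then show "convergent X"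
    by (rule convergentI)
next
  fix x y z :: "('a, 'b) ell2" and a b :: complex and r :: real
  show "a *\<^sub>C (x + y) = a *\<^sub>C x + a *\<^sub>C y" "(a + b) *\<^sub>C x = a *\<^sub>C x + b *\<^sub>C x"
    "a *\<^sub>C b *\<^sub>C x = (a * b) *\<^sub>C x" "complex_of_real r *\<^sub>C x = r *\<^sub>R x"
    by (rule ell2_eqI, simp add: ell2_nth_simps scaleC_ell2_nth scaleC_add_left scaleC_add_right
        scaleC_scaleC scaleC_of_real)+
  show "cinner x y = cnj (cinner y x)"
    unfolding cinner_ell2_def infsum_cnj[symmetric] by (simp add: cinner_commute[symmetric])
  show "cinner (x + y) z = cinner x z + cinner y z"
    unfolding cinner_ell2_def
    by (simp add: ell2_nth_simps cinner_add_left infsum_add ell2_cinner_summable)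
  show "cinner (a *\<^sub>C x) y = a * cinner x y"
    unfolding cinner_ell2_def
    by (simp add: scaleC_ell2_nth cinner_scaleC_left infsum_cmult_right')
  show "Re (cinner x y) = inner x y"
    unfolding cinner_ell2_def inner_ell2_def
    by (subst infsum_Re[symmetric]) (auto simp: ell2_cinner_summable Re_cinner)
qed

end

text \<open>The spaces \<open>V\<close>, \<open>W\<close> below are meant to be closed complex subspaces of the
  ambient Hilbert spaces (\<open>UNIV\<close> in the case of \<open>H\<close> and \<open>K\<close>), and an operator on \<open>V\<close>
  is a function that is \<open>undefined\<close> outside \<open>V\<close>, so that operators which agree on \<open>V\<close> are equal.\<close>

definition bounded_ops ::
  "'a::chilbert_space set \<Rightarrow> 'b::chilbert_space set \<Rightarrow> ('a \<Rightarrow> 'b) set" where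
  "bounded_ops V W = {T \<in> V \<rightarrow>\<^sub>E W.
     (\<forall>x\<in>V. \<forall>y\<in>V. T (x + y) = T x + T y) \<and>
     (\<forall>c. \<forall>x\<in>V. T (c *\<^sub>C x) = c *\<^sub>C T x) \<and>
     (\<exists>B. \<forall>x\<in>V. norm (T x) \<le> B * norm x)}"

definition op_norm :: "'a::chilbert_space set \<Rightarrow> ('a \<Rightarrow> 'b::chilbert_space) \<Rightarrow> real" where
  "op_norm V T = (SUP x\<in>{x\<in>V. norm x \<le> 1}. norm (T x))"

definition adjoint_op ::
  "'a::chilbert_space set \<Rightarrow> 'b::chilbert_space set \<Rightarrow> ('a \<Rightarrow> 'b) \<Rightarrow> 'b \<Rightarrow> 'a" where
  "adjoint_op V W T =
     (THE A. A \<in> bounded_ops W V \<and> (\<forall>x\<in>V. \<forall>y\<in>W. cinner (T x) y = cinner x (A y)))"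

definition unitary_op ::
  "'a::chilbert_space set \<Rightarrow> 'b::chilbert_space set \<Rightarrow> ('a \<Rightarrow> 'b) \<Rightarrow> bool" where
  "unitary_op V W U \<longleftrightarrow> U \<in> bounded_ops V W \<and>
     compose V (adjoint_op V W U) U = (\<lambda>x\<in>V. x) \<and>
     compose W U (adjoint_op V W U) = (\<lambda>y\<in>W. y)"

definition op_subspace ::
  "'a::chilbert_space set \<Rightarrow> 'b::chilbert_space set \<Rightarrow> ('a \<Rightarrow> 'b) set \<Rightarrow> bool" where
  "op_subspace V W X \<longleftrightarrow> X \<subseteq> bounded_ops V W \<and> (\<lambda>x\<in>V. 0) \<in> X \<and>
     (\<forall>A\<in>X. \<forall>B\<in>X. (\<lambda>x\<in>V. A x + B x) \<in> X) \<and>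
     (\<forall>c. \<forall>A\<in>X. (\<lambda>x\<in>V. c *\<^sub>C A x) \<in> X)"

definition op_span ::
  "'a::chilbert_space set \<Rightarrow> ('a \<Rightarrow> 'b::chilbert_space) set \<Rightarrow> ('a \<Rightarrow> 'b) set" where
  "op_span V X = {(\<lambda>x\<in>V. \<Sum>i<n. c i *\<^sub>C A i x) |(n::nat) c A. \<forall>i<n. A i \<in> X}"

text \<open>The \<open>w\<^sup>*\<close>-topology of \<open>B(V)\<close> (as the dual of the trace class operators) is the
  weakest one making the normal functionals \<open>A \<mapsto> \<Sum>n. \<langle>A x\<^sub>n, y\<^sub>n\<rangle>\<close>, with
  \<open>\<Sum>n. \<parallel>x\<^sub>n\<parallel>\<^sup>2\<close> and \<open>\<Sum>n. \<parallel>y\<^sub>n\<parallel>\<^sup>2\<close> finite, continuous.\<close>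

definition wstar_topology :: "'a::chilbert_space set \<Rightarrow> ('a \<Rightarrow> 'a) topology" where
  "wstar_topology V = topology_generated_by
     {{A \<in> bounded_ops V V. (\<Sum>n. cinner (A (x n)) (y n)) \<in> G} |x y G.
        range x \<subseteq> V \<and> range y \<subseteq> V \<and>
        summable (\<lambda>n. (norm (x n))\<^sup>2) \<and> summable (\<lambda>n. (norm (y n))\<^sup>2) \<and> open G}"

definition wstar_span :: "'a::chilbert_space set \<Rightarrow> ('a \<Rightarrow> 'a) set \<Rightarrow> ('a \<Rightarrow> 'a) set" where
  "wstar_span V X = wstar_topology V closure_of op_span V X"

definition operator_system :: "'a::chilbert_space set \<Rightarrow> ('a \<Rightarrow> 'a) set \<Rightarrow> bool" where
  "operator_system V S \<longleftrightarrow> op_subspace V V S \<and>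
     (\<lambda>x\<in>V. x) \<in> S \<and> (\<forall>s\<in>S. adjoint_op V V s \<in> S) \<and>
     (\<forall>X. \<forall>A\<in>bounded_ops V V. (\<forall>n::nat. X n \<in> S) \<and>
        (\<lambda>n. op_norm V (\<lambda>x\<in>V. X n x - A x)) \<longlonglongrightarrow> 0 \<longrightarrow> A \<in> S)"

definition dual_operator_system :: "'a::chilbert_space set \<Rightarrow> ('a \<Rightarrow> 'a) set \<Rightarrow> bool" where
  "dual_operator_system V S \<longleftrightarrow> operator_system V S \<and> closedin (wstar_topology V) S"

definition tro ::
  "'a::chilbert_space set \<Rightarrow> 'b::chilbert_space set \<Rightarrow> ('a \<Rightarrow> 'b) set \<Rightarrow> bool" where
  "tro V W M \<longleftrightarrow> op_subspace V W M \<and>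
     (\<forall>l\<in>M. \<forall>m\<in>M. \<forall>n\<in>M. compose V l (compose V (adjoint_op V W m) n) \<in> M)"

definition tro_equivalent ::
  "'a::chilbert_space set \<Rightarrow> 'b::chilbert_space set \<Rightarrow> ('a \<Rightarrow> 'a) set \<Rightarrow> ('b \<Rightarrow> 'b) set \<Rightarrow> bool" where
  "tro_equivalent V W S T \<longleftrightarrow> (\<exists>M. tro V W M \<and>
     wstar_span W {compose W m (compose W s (adjoint_op V W n)) |m s n. m \<in> M \<and> s \<in> S \<and> n \<in> M} = T \<and>
     wstar_span V {compose V (adjoint_op V W m) (compose V t n) |m t n. m \<in> M \<and> t \<in> T \<and> n \<in> M} = S)"

text \<open>\<open>ell2_on J\<close> is \<open>\<ell>\<^sup>2\<^sub>J\<close> when the coefficients are complex numbers. With coefficients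
  in \<open>H\<close> it is the standard model of \<open>H \<otimes> \<ell>\<^sup>2\<^sub>J\<close>, whose elementary tensors are
  the families \<open>ell2_tensor h x\<close>.\<close>

definition ell2_on :: "'j set \<Rightarrow> ('j, 'a::chilbert_space) ell2 set" where
  "ell2_on J = {f. \<forall>j. j \<notin> J \<longrightarrow> ell2_nth f j = 0}"

definition ell2_tensor :: "'a::chilbert_space \<Rightarrow> ('j, complex) ell2 \<Rightarrow> ('j, 'a) ell2" where
  "ell2_tensor h x = Abs_ell2 (\<lambda>j. ell2_nth x j *\<^sub>C h)"

lemma ell2_tensor_nth: "ell2_nth (ell2_tensor h x) j = ell2_nth x j *\<^sub>C h"
proof -
  have "(\<lambda>j. (norm (ell2_nth x j *\<^sub>C h))\<^sup>2) summable_on UNIV"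
    using summable_on_cmult_left[OF ell2_summable[of x], of "(norm h)\<^sup>2"]
    by (simp add: norm_scaleC power_mult_distrib)
  then show ?thesis
    unfolding ell2_tensor_def by (subst Abs_ell2_inverse) simp_all
qed

lemma ell2_tensor_in_ell2_on: "x \<in> ell2_on J \<Longrightarrow> ell2_tensor h x \<in> ell2_on J"
  using scaleC_of_real[of 0 h] by (simp add: ell2_on_def ell2_tensor_nth)

lemma cinner_ell2_tensor:
  "cinner (ell2_tensor h x) (ell2_tensor k y) = cinner h k * cinner x y"
proof -
  have "cinner (ell2_tensor h x) (ell2_tensor k y)
      = (\<Sum>\<^sub>\<infinity>j. cinner (ell2_nth x j) (ell2_nth y j) * cinner h k)"
    unfolding cinner_ell2_def
    by (simp add: ell2_tensor_nth cinner_scaleC_left cinner_scaleC_right cinner_complex_def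
        mult_ac)
  also have "\<dots> = cinner x y * cinner h k"
    unfolding cinner_ell2_def by (rule infsum_cmult_left')
  finally show ?thesis by (simp add: mult.commute)
qed

text \<open>Since elementary tensors span a dense subspace, the conditions below determine
  \<open>A = s \<otimes> a\<close> uniquely.\<close>

definition is_tensor_op ::
  "'j set \<Rightarrow> ('a::chilbert_space \<Rightarrow> 'a) \<Rightarrow> (('j, complex) ell2 \<Rightarrow> ('j, complex) ell2) \<Rightarrow>
    (('j, 'a) ell2 \<Rightarrow> ('j, 'a) ell2) \<Rightarrow> bool" where
  "is_tensor_op J s a A \<longleftrightarrow> A \<in> bounded_ops (ell2_on J) (ell2_on J) \<and>
     (\<forall>h. \<forall>x\<in>ell2_on J. A (ell2_tensor h x) = ell2_tensor (s h) (a x))"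

text \<open>\<open>S \<otimes> M\<^sub>J\<close> (\<open>w\<^sup>*\<close>-closed spatial tensor product), for \<open>S \<subseteq> B(H)\<close>.\<close>

definition amplification ::
  "('a::chilbert_space \<Rightarrow> 'a) set \<Rightarrow> 'j set \<Rightarrow> (('j, 'a) ell2 \<Rightarrow> ('j, 'a) ell2) set" where
  "amplification S J = wstar_span (ell2_on J)
     {A. \<exists>s\<in>S. \<exists>a\<in>bounded_ops (ell2_on J) (ell2_on J). is_tensor_op J s a A}"

end

theory Submission
  imports Defs
begin

text \<open>A subspace of \<open>B(H, K)\<close> is \<open>w\<^sup>*\<close>-closed iff it is the common kernel of the normal
  functionals vanishing on it, so \<open>w\<^sup>*\<close>-closures can be handled as bipolars, and every
  inclusion between products of closures reduces to generators. With \<open>M\<close> the given TRO, let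
  \<open>N\<close> be the bipolar of the matrices over \<open>J\<close> with entries in \<open>M\<close>. Then
  \<open>N (S \<otimes> M\<^sub>J) N\<^sup>* \<subseteq> T \<otimes> M\<^sub>J\<close> and \<open>N\<^sup>* (T \<otimes> M\<^sub>J) N \<subseteq> S \<otimes> M\<^sub>J\<close>, so a unitary in \<open>N\<close> suffices.
  Since \<open>S\<close> and \<open>T\<close> are unital, \<open>M\<close> and \<open>M\<^sup>*\<close> are nondegenerate, and Zorn's lemma yields
  families in their closures with \<open>\<Sum>z\<^sup>* z = 1\<close>. Arranged as columns, these amplify to isometries
  \<open>V \<in> N\<close> and \<open>W \<in> N\<^sup>*\<close>. The operator-theoretic Cantor--Bernstein argument then gives the unitary
  \<open>V P + W\<^sup>* (1 - P)\<close>, where \<open>P = \<Sum>\<^sub>n (W V)\<^sup>n (1 - W W\<^sup>*) (W V)\<^sup>*\<^sup>n\<close>. The index set \<open>J\<close> can be the whole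
  type \<open>H \<times> K \<times> nat\<close>: only countably many members of such a family are nonzero at a given vector.\<close>

section \<open>Adjoints\<close>

lemma scaleC_zero_left [simp]: "0 *\<^sub>C (x::'a::chilbert_space) = 0"
  using scaleC_of_real[of 0 x] by simp

lemma scaleC_one [simp]: "1 *\<^sub>C (x::'a::chilbert_space) = x"
  using scaleC_of_real[of 1 x] by simp

lemma scaleC_zero_right [simp]: "c *\<^sub>C (0::'a::chilbert_space) = 0"
  by (metis norm_eq_zero norm_scaleC mult_zero_right)

lemma scaleC_minus_one: "(-1) *\<^sub>C (x::'a::chilbert_space) = - x"
  using scaleC_of_real[of "-1" x] by simp

lemma scaleC_eq_0_iff: "c *\<^sub>C (x::'a::chilbert_space) = 0 \<longleftrightarrow> c = 0 \<or> x = 0"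
  by (metis mult_eq_0_iff norm_eq_zero norm_scaleC)

lemma cinner_zero_left [simp]: "cinner 0 (x::'a::chilbert_space) = 0"
  using cinner_scaleC_left[of 0 x x] by simp

lemma cinner_zero_right [simp]: "cinner (x::'a::chilbert_space) 0 = 0"
  using cinner_scaleC_right[of x 0 x] by simp

lemma cinner_minus_left: "cinner (- (x::'a::chilbert_space)) y = - cinner x y"
  using cinner_scaleC_left[of "-1" x y] by (simp add: scaleC_minus_one)

lemma cinner_minus_right: "cinner (x::'a::chilbert_space) (- y) = - cinner x y"
  using cinner_scaleC_right[of x "-1" y] by (simp add: scaleC_minus_one)

lemma cinner_diff_left: "cinner ((x::'a::chilbert_space) - y) z = cinner x z - cinner y z"
  by (metis cinner_add_left cinner_minus_left diff_conv_add_uminus)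

lemma cinner_diff_right: "cinner (x::'a::chilbert_space) (y - z) = cinner x y - cinner x z"
  by (metis cinner_add_right cinner_minus_right diff_conv_add_uminus)

lemma cinner_eqI:
  fixes x y :: "'a::chilbert_space"
  assumes "\<And>z. cinner x z = cinner y z"
  shows "x = y"
proof -
  have "cinner (x - y) (x - y) = 0"
    using assms by (simp add: cinner_diff_left)
  then show ?thesis
    by (simp add: cinner_self)
qed

lemma Im_cinner: "Im (cinner x y) = inner ((- \<i>) *\<^sub>C (x::'a::chilbert_space)) y"
  by (simp add: Re_cinner[symmetric] cinner_scaleC_left)

lemma scaleR_conv_scaleC: "r *\<^sub>R (x::'a::chilbert_space) = complex_of_real r *\<^sub>C x"
  by (simp add: scaleC_of_real)

text \<open>The representing vector minimises \<open>\<parallel>x\<parallel>\<^sup>2 / 2 - f x\<close>; a minimising sequence is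
  Cauchy by the parallelogram law.\<close>

lemma riesz_representation:
  fixes f :: "'a::{real_inner, complete_space} \<Rightarrow> real"
  assumes f: "bounded_linear f"
  shows "\<exists>y. \<forall>x. f x = inner y x"
proof -
  interpret bounded_linear f by (rule f)
  obtain B where B: "\<And>x. norm (f x) \<le> norm x * B"
    using bounded by blast
  define q where "q x = (norm x)\<^sup>2 / 2 - f x" for x
  have bdd: "bdd_below (range q)"
  proof (rule bdd_belowI2)
    fix x
    have "f x \<le> norm x * B" using B[of x] by simp
    moreover have "0 \<le> (norm x - B)\<^sup>2" by simp
    ultimately show "- (B\<^sup>2 / 2) \<le> q x"
      by (simp add: q_def power2_diff)
  qed
  define I where "I = Inf (range q)"
  have I: "I \<le> q x" for x
    unfolding I_def by (rule cInf_lower[OF _ bdd]) simp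
  have "\<exists>x. q x < I + 1 / Suc n" for n
  proof -
    have "Inf (range q) < I + 1 / Suc n"
      by (simp add: I_def)
    then show ?thesis
      using cInf_lessD[of "range q" "I + 1 / Suc n"] by auto
  qed
  then obtain X where X: "\<And>n. q (X n) < I + 1 / Suc n"
    by metis
  have mid: "(norm (x - y))\<^sup>2 / 4 = q x + q y - 2 * q ((1/2) *\<^sub>R (x + y))" for x y
  proof -
    have "(norm ((1/2) *\<^sub>R (x + y)))\<^sup>2 = (norm (x + y))\<^sup>2 / 4"
      by (simp add: power_divide)
    then show ?thesis
      by (simp add: q_def scaleR add power2_norm_eq_inner inner_diff_left inner_diff_right
          inner_add_left inner_add_right inner_commute field_simps)
  qed
  have near: "(norm (X m - X n))\<^sup>2 \<le> 8 / Suc N" if "m \<ge> N" "n \<ge> N" for m n N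
  proof -
    have "1 / real (Suc m) \<le> 1 / Suc N" "1 / real (Suc n) \<le> 1 / Suc N"
      using that by (simp_all add: frac_le)
    then show ?thesis
      using mid[of "X m" "X n"] X[of m] X[of n] I[of "(1/2) *\<^sub>R (X m + X n)"] by linarith
  qed
  have "Cauchy X"
    unfolding Cauchy_def dist_norm
  proof (intro allI impI)
    fix e :: real assume e: "e > 0"
    obtain N where N: "8 / e\<^sup>2 < real N"
      using reals_Archimedean2 by blast
    then have "8 / Suc N < e\<^sup>2"
      using e by (simp add: field_simps add_strict_increasing)
    then have "(norm (X m - X n))\<^sup>2 < e\<^sup>2" if "m \<ge> N" "n \<ge> N" for m n
      using near[OF that] by linarith
    then show "\<exists>M. \<forall>m\<ge>M. \<forall>n\<ge>M. norm (X m - X n) < e"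
      using e by (metis power2_less_imp_less less_eq_real_def)
  qed
  then obtain y where y: "X \<longlonglongrightarrow> y"
    using Cauchy_convergent_iff convergent_def by blast
  have "(\<lambda>n. q (X n)) \<longlonglongrightarrow> q y"
    unfolding q_def by (intro tendsto_intros tendsto y) simp
  moreover have "(\<lambda>n. I + 1 / Suc n) \<longlonglongrightarrow> I"
    using tendsto_add[OF tendsto_const[of I] LIMSEQ_inverse_real_of_nat] by (simp add: inverse_eq_divide)
  ultimately have "q y \<le> I"
    by (rule LIMSEQ_le) (use X less_imp_le in blast)
  then have min: "q y \<le> q x" for x
    using I[of x] by simp
  have "f x = inner y x" for x
  proof (rule ccontr)
    assume ne: "f x \<noteq> inner y x"
    define d where "d = f x - inner y x"
    \<comment> \<open>Moving from \<open>y\<close> by \<open>t *\<^sub>R x\<close> changes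
      \<open>q\<close> by \<open>- t * d + t\<^sup>2 * (norm x)\<^sup>2 / 2\<close>, which is
      negative for this \<open>t\<close>, since \<open>d\<close> is nonzero. The \<open>+ 1\<close>
      keeps the denominator positive even for \<open>x = 0\<close>.\<close>
    define t where "t = d / ((norm x)\<^sup>2 + 1)"
    have pos: "(norm x)\<^sup>2 + 1 > 0"
      by (simp add: add_nonneg_pos)
    have exp: "q (y + t *\<^sub>R x) = q y - t * d + t\<^sup>2 * (norm x)\<^sup>2 / 2"
      unfolding q_def d_def add scaleR power2_norm_eq_inner inner_add_left inner_add_right
      by (simp add: inner_commute power2_eq_square field_simps)
    have "t * d = t\<^sup>2 * ((norm x)\<^sup>2 + 1)"
      using pos by (simp add: t_def power2_eq_square)
    then have "q (y + t *\<^sub>R x) = q y - t\<^sup>2 * ((norm x)\<^sup>2 / 2 + 1)"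
      unfolding exp by (simp add: algebra_simps)
    moreover have "t\<^sup>2 * ((norm x)\<^sup>2 / 2 + 1) > 0"
    proof (rule mult_pos_pos)
      show "0 < t\<^sup>2" using ne pos by (simp add: t_def d_def)
      show "0 < (norm x)\<^sup>2 / 2 + 1" by (simp add: add_nonneg_pos)
    qed
    ultimately show False
      using min[of "y + t *\<^sub>R x"] by linarith
  qed
  then show ?thesis by blast
qed

section \<open>Bounded operators between whole spaces and their adjoints\<close>

abbreviation bop :: "('a::chilbert_space \<Rightarrow> 'b::chilbert_space) set" where
  "bop \<equiv> bounded_ops UNIV UNIV"

abbreviation adj :: "('a::chilbert_space \<Rightarrow> 'b::chilbert_space) \<Rightarrow> 'b \<Rightarrow> 'a" where
  "adj \<equiv> adjoint_op UNIV UNIV"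

lemma bop_iff: "T \<in> bop \<longleftrightarrow> (\<forall>x y. T (x + y) = T x + T y) \<and> (\<forall>c x. T (c *\<^sub>C x) = c *\<^sub>C T x) \<and>
    (\<exists>B. \<forall>x. norm (T x) \<le> B * norm x)"
  by (simp add: bounded_ops_def)

lemma bopI:
  assumes "\<And>x y. T (x + y) = T x + T y" "\<And>c x. T (c *\<^sub>C x) = c *\<^sub>C T x"
    "\<And>x. norm (T x) \<le> B * norm x"
  shows "T \<in> bop"
  using assms unfolding bop_iff by blast

lemma bop_add: "T \<in> bop \<Longrightarrow> T (x + y) = T x + T y"
  and bop_scaleC: "T \<in> bop \<Longrightarrow> T (c *\<^sub>C x) = c *\<^sub>C T x"
  by (simp_all add: bop_iff)

lemma bop_zero: "T \<in> bop \<Longrightarrow> T 0 = 0"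
  using bop_scaleC[of T 0 0] by simp

lemma bop_minus: "T \<in> bop \<Longrightarrow> T (- x) = - T x"
  using bop_scaleC[of T "-1" x] by (simp add: scaleC_minus_one)

lemma bop_diff: "T \<in> bop \<Longrightarrow> T (x - y) = T x - T y"
  by (metis bop_add bop_minus diff_conv_add_uminus)

lemma bop_bound:
  assumes "T \<in> bop"
  obtains B where "B > 0" "\<And>x. norm (T x) \<le> B * norm x"
proof -
  obtain B where B: "\<And>x. norm (T x) \<le> B * norm x"
    using assms unfolding bop_iff by blast
  have "norm (T x) \<le> (\<bar>B\<bar> + 1) * norm x" for x
    using B[of x] mult_right_mono[of B "\<bar>B\<bar> + 1" "norm x"] by fastforce
  then show ?thesis
    using that[of "\<bar>B\<bar> + 1"] by fastforce
qed

lemma bop_bounded_linear: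
  assumes "T \<in> bop" shows "bounded_linear T"
proof -
  obtain B where "\<And>x. norm (T x) \<le> B * norm x"
    using bop_bound[OF assms] by blast
  then show ?thesis
    by (intro bounded_linear_intro[where K=B])
      (simp_all add: assms bop_add scaleR_conv_scaleC bop_scaleC mult.commute)
qed

lemma bop_id [simp]: "(\<lambda>x. x) \<in> bop"
  by (rule bopI[where B=1]) auto

lemma bop_0 [simp]: "(\<lambda>x. 0) \<in> bop"
  by (rule bopI[where B=0]) auto

lemma bop_plus:
  assumes "A \<in> bop" "B \<in> bop" shows "(\<lambda>x. A x + B x) \<in> bop"
proof -
  obtain a b where ab: "\<And>x. norm (A x) \<le> a * norm x" "\<And>x. norm (B x) \<le> b * norm x"
    using assms bop_bound by metis
  have "norm (A x + B x) \<le> (a + b) * norm x" for x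
    using norm_triangle_ineq[of "A x" "B x"] ab[of x] by (simp add: distrib_right)
  then show ?thesis
    by (intro bopI[where B="a + b"]) (simp_all add: assms bop_add bop_scaleC scaleC_add_right)
qed

lemma bop_scale:
  assumes "A \<in> bop" shows "(\<lambda>x. c *\<^sub>C A x) \<in> bop"
proof -
  obtain a where "\<And>x. norm (A x) \<le> a * norm x"
    using assms bop_bound by metis
  then have "norm (c *\<^sub>C A x) \<le> (cmod c * a) * norm x" for x
    by (simp add: norm_scaleC mult.assoc mult_left_mono)
  then show ?thesis
    by (intro bopI[where B="cmod c * a"])
      (auto simp: assms bop_add bop_scaleC scaleC_add_right scaleC_scaleC mult.commute)
qed

lemma bop_sub: "A \<in> bop \<Longrightarrow> B \<in> bop \<Longrightarrow> (\<lambda>x. A x - B x) \<in> bop"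
  using bop_plus[of A "\<lambda>x. (-1) *\<^sub>C B x"] bop_scale[of B "-1"] by (simp add: scaleC_minus_one)

lemma bop_comp:
  assumes "A \<in> bop" "B \<in> bop" shows "(\<lambda>x. A (B x)) \<in> bop"
proof -
  obtain a b where a: "a > 0" "\<And>x. norm (A x) \<le> a * norm x" and b: "\<And>x. norm (B x) \<le> b * norm x"
    using assms bop_bound by metis
  have "norm (A (B x)) \<le> (a * b) * norm x" for x
    using order_trans[OF a(2)[of "B x"] mult_left_mono[OF b[of x], of a]] a(1)
    by (simp add: mult.assoc)
  then show ?thesis
    by (intro bopI[where B="a * b"]) (auto simp: assms bop_add bop_scaleC)
qed

text \<open>Riesz applied to \<open>\<lambda>x. inner (T x) y\<close> gives the adjoint identity for
  real parts; the imaginary parts follow because \<open>T\<close> commutes with multiplication by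
  \<open>- \<i>\<close>. The bound on \<open>A\<close> comes from testing the identity at
  \<open>x = A y\<close>.\<close>

lemma adjoint_exists:
  assumes T: "T \<in> bop"
  shows "\<exists>A. A \<in> bop \<and> (\<forall>x y. cinner (T x) y = cinner x (A y))"
proof -
  have "\<exists>z. \<forall>x. inner (T x) y = inner z x" for y
    by (rule riesz_representation[OF bounded_linear_compose[OF bounded_linear_inner_left
            bop_bounded_linear[OF T]]])
  then obtain A where A: "\<And>x y. inner (T x) y = inner x (A y)"
    by (metis inner_commute)
  have eq: "cinner (T x) y = cinner x (A y)" for x y
  proof (rule complex_eqI)
    show "Re (cinner (T x) y) = Re (cinner x (A y))"
      by (simp add: Re_cinner A)
    show "Im (cinner (T x) y) = Im (cinner x (A y))"
      by (simp add: Im_cinner bop_scaleC[OF T, symmetric] A)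
  qed
  have eq': "cinner (A y) x = cinner y (T x)" for x y
    using eq[of x y] by (metis cinner_commute)
  obtain B where B: "B > 0" "\<And>x. norm (T x) \<le> B * norm x"
    using bop_bound[OF T] by blast
  have "A \<in> bop"
  proof (rule bopI)
    show "A (x + y) = A x + A y" for x y
      by (rule cinner_eqI) (simp add: eq' cinner_add_left)
    show "A (c *\<^sub>C x) = c *\<^sub>C A x" for c x
      by (rule cinner_eqI) (simp add: eq' cinner_scaleC_left)
    show "norm (A y) \<le> B * norm y" for y
    proof (cases "A y = 0")
      case False
      have "norm (A y) * norm (A y) = inner (T (A y)) y"
        by (simp add: A power2_norm_eq_inner[symmetric] power2_eq_square[symmetric])
      also have "\<dots> \<le> (B * norm (A y)) * norm y"
        by (rule order_trans[OF norm_cauchy_schwarz mult_right_mono[OF B(2)]]) simp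
      finally show ?thesis
        using False by (simp add: mult.commute mult.left_commute)
    qed (use B in simp)
  qed
  then show ?thesis
    using eq by blast
qed

text \<open>This trades the definite description in \<open>adjoint_op\<close> for a check of the
  adjoint identity; the adjoints below are computed through it.\<close>

lemma adjoint_unique:
  assumes "A \<in> bop" "\<And>x y. cinner (T x) y = cinner x (A y)"
  shows "adj T = A"
  unfolding adjoint_op_def
proof (rule the_equality)
  fix A' assume "A' \<in> bop \<and> (\<forall>x\<in>UNIV. \<forall>y\<in>UNIV. cinner (T x) y = cinner x (A' y))"
  then have "cinner (A' y) x = cinner (A y) x" for x y
    using assms(2) by (metis cinner_commute UNIV_I)
  then show "A' = A"
    by (blast intro: ext cinner_eqI)
qed (use assms in auto)

lemma
  assumes "T \<in> bop"
  shows bop_adj: "adj T \<in> bop" and cinner_adj_right: "cinner x (adj T y) = cinner (T x) y"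
  using adjoint_exists[OF assms] adjoint_unique[of _ T] by metis+

lemma cinner_adj_left: "T \<in> bop \<Longrightarrow> cinner (adj T x) y = cinner x (T y)"
  by (metis cinner_adj_right cinner_commute)

lemma adj_adj: "T \<in> bop \<Longrightarrow> adj (adj T) = T"
  by (rule adjoint_unique) (simp_all add: cinner_adj_left)

lemma adj_comp:
  "A \<in> bop \<Longrightarrow> B \<in> bop \<Longrightarrow> adj (\<lambda>x. A (B x)) = (\<lambda>x. adj B (adj A x))"
  by (rule adjoint_unique) (simp_all add: cinner_adj_right bop_comp bop_adj)

lemma adj_plus: "A \<in> bop \<Longrightarrow> B \<in> bop \<Longrightarrow> adj (\<lambda>x. A x + B x) = (\<lambda>x. adj A x + adj B x)"
  by (rule adjoint_unique)
    (simp_all add: cinner_adj_right bop_plus bop_adj cinner_add_left cinner_add_right)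

lemma adj_sub: "A \<in> bop \<Longrightarrow> B \<in> bop \<Longrightarrow> adj (\<lambda>x. A x - B x) = (\<lambda>x. adj A x - adj B x)"
  by (rule adjoint_unique)
    (simp_all add: cinner_adj_right bop_sub bop_adj cinner_diff_left cinner_diff_right)

lemma adj_id: "adj (\<lambda>x. x) = (\<lambda>x. x)"
  by (rule adjoint_unique) simp_all

lemma adj_self_comp:
  "A \<in> bop \<Longrightarrow> adj (\<lambda>x. adj A (A x)) = (\<lambda>x. adj A (A x))"
  by (simp add: adj_comp adj_adj bop_adj)

text \<open>Polarization of the real inner product is enough, since \<open>inner\<close> already
  separates vectors.\<close>

lemma isometry_adj_comp:
  assumes V: "V \<in> bop" and iso: "\<And>x. norm (V x) = norm x"
  shows "adj V (V x) = x"
proof -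
  have iso_inner: "inner (V x) (V y) = inner x y" for x y
  proof -
    have "(norm (V (x + y)))\<^sup>2 = (norm (x + y))\<^sup>2" "(norm (V x))\<^sup>2 = (norm x)\<^sup>2"
      "(norm (V y))\<^sup>2 = (norm y)\<^sup>2"
      by (simp_all add: iso)
    then show ?thesis
      by (simp add: bop_add[OF V] power2_norm_eq_inner inner_add_left inner_add_right inner_commute)
  qed
  have "inner (adj V (V x) - x) y = 0" for y
    using iso_inner[of x y]
    by (simp add: inner_diff_left Re_cinner[symmetric] cinner_diff_left cinner_adj_left V)
  then show ?thesis
    using inner_eq_zero_iff[of "adj V (V x) - x"] by simp
qed

lemma unitary_op_UNIV_iff:
  "unitary_op UNIV UNIV U \<longleftrightarrow> U \<in> bop \<and> (\<forall>x. adj U (U x) = x) \<and> (\<forall>y. U (adj U y) = y)"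
  unfolding unitary_op_def compose_def by (auto simp: fun_eq_iff)

lemma compose_UNIV: "compose UNIV f g = (\<lambda>x. f (g x))"
  by (simp add: compose_def restrict_UNIV)

section \<open>The bipolar theorem for normal functionals\<close>

lemma Abs_ell2_nth:
  "(\<lambda>j. (norm (f j))\<^sup>2) summable_on UNIV \<Longrightarrow> ell2_nth (Abs_ell2 f) j = f j"
  by (subst Abs_ell2_inverse) simp_all

definition map_ell2 :: "('a::chilbert_space \<Rightarrow> 'b::chilbert_space) \<Rightarrow> ('i, 'a) ell2 \<Rightarrow> ('i, 'b) ell2" where
  "map_ell2 T x = Abs_ell2 (\<lambda>i. T (ell2_nth x i))"

lemma map_ell2_nth:
  assumes T: "T \<in> bop" shows "ell2_nth (map_ell2 T x) i = T (ell2_nth x i)"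
proof -
  obtain B where B: "B > 0" "\<And>v. norm (T v) \<le> B * norm v"
    using bop_bound[OF T] by blast
  have "(norm (T v))\<^sup>2 \<le> B\<^sup>2 * (norm v)\<^sup>2" for v
    using power_mono[OF B(2)[of v], of 2] by (simp add: power_mult_distrib)
  then have "(\<lambda>i. (norm (T (ell2_nth x i)))\<^sup>2) summable_on UNIV"
    by (intro summable_on_comparison_test[OF summable_on_cmult_right[OF ell2_summable[of x]]]) auto
  then show ?thesis
    unfolding map_ell2_def by (rule Abs_ell2_nth)
qed

text \<open>Packing the two sequences into vectors of \<open>ell2\<close> over \<open>nat\<close>
  makes the functional a single inner product, with \<open>T\<close> acting entrywise. Two different
  spaces are allowed, because the ternary ring lives between \<open>H\<close> and
  \<open>K\<close>.\<close>

definition normal_fn :: "(nat, 'a::chilbert_space) ell2 \<Rightarrow> (nat, 'b::chilbert_space) ell2 \<Rightarrow> ('a \<Rightarrow> 'b) \<Rightarrow> complex" where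
  "normal_fn x y T = cinner (map_ell2 T x) y"

lemma normal_fn_infsum: "T \<in> bop \<Longrightarrow> normal_fn x y T = (\<Sum>\<^sub>\<infinity>n. cinner (T (ell2_nth x n)) (ell2_nth y n))"
  by (simp add: normal_fn_def cinner_ell2_def map_ell2_nth)

lemma normal_fn_has_sum:
  "T \<in> bop \<Longrightarrow> ((\<lambda>n. cinner (T (ell2_nth x n)) (ell2_nth y n)) has_sum normal_fn x y T) UNIV"
  using has_sum_infsum[OF ell2_cinner_summable[of "map_ell2 T x" y]]
  by (simp add: normal_fn_def cinner_ell2_def map_ell2_nth)

lemma normal_fn_plus:
  assumes "A \<in> bop" "B \<in> bop" shows "normal_fn x y (\<lambda>v. A v + B v) = normal_fn x y A + normal_fn x y B"
proof -
  have "((\<lambda>n. cinner (A (ell2_nth x n) + B (ell2_nth x n)) (ell2_nth y n)) has_sum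
      normal_fn x y A + normal_fn x y B) UNIV"
    using has_sum_add[OF normal_fn_has_sum normal_fn_has_sum] assms by (simp add: cinner_add_left)
  then show ?thesis
    using has_sum_unique normal_fn_has_sum[OF bop_plus[OF assms]] by blast
qed

lemma normal_fn_scale: "A \<in> bop \<Longrightarrow> normal_fn x y (\<lambda>v. c *\<^sub>C A v) = c * normal_fn x y A"
  by (simp add: normal_fn_infsum bop_scale cinner_scaleC_left infsum_cmult_right')

text \<open>Moving \<open>R\<close> and \<open>L\<close> onto the defining vectors leaves a normal
  functional of \<open>A\<close>: multiplication is separately w*-continuous.\<close>

lemma normal_fn_comp:
  assumes "L \<in> bop" "A \<in> bop" "R \<in> bop"
  shows "normal_fn x y (\<lambda>v. L (A (R v))) = normal_fn (map_ell2 R x) (map_ell2 (adj L) y) A"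
  unfolding normal_fn_infsum[OF bop_comp[OF assms(1) bop_comp[OF assms(2,3)]]] normal_fn_infsum[OF assms(2)]
  using assms by (simp add: map_ell2_nth bop_adj cinner_adj_right)

lemma normal_fn_adj:
  assumes "A \<in> bop" shows "normal_fn x y (adj A) = cnj (normal_fn y x A)"
proof -
  have "cinner (adj A v) w = cnj (cinner (A w) v)" for v w
    using assms by (metis cinner_adj_left cinner_commute)
  then show ?thesis
    using assms by (simp add: normal_fn_infsum bop_adj flip: infsum_cnj)
qed

lemma has_sum_sum_type:
  fixes f :: "'i + 'j \<Rightarrow> 'c::topological_comm_monoid_add"
  assumes "((\<lambda>i. f (Inl i)) has_sum a) UNIV" "((\<lambda>i. f (Inr i)) has_sum b) UNIV"
  shows "(f has_sum (a + b)) UNIV"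
proof -
  have "(f has_sum a) (range Inl)" "(f has_sum b) (range Inr)"
    using assms by (simp_all add: has_sum_reindex o_def)
  then have "(f has_sum (a + b)) (range Inl \<union> range Inr)"
    by (rule has_sum_Un_disjoint) auto
  then show ?thesis
    by (simp add: UNIV_sum)
qed

lemma has_sum_interleave:
  fixes f :: "nat + nat \<Rightarrow> 'c::topological_comm_monoid_add"
  assumes "((\<lambda>i. f (Inl i)) has_sum a) UNIV" "((\<lambda>i. f (Inr i)) has_sum b) UNIV"
  shows "((\<lambda>n. f (sum_decode n)) has_sum (a + b)) UNIV"
  using has_sum_sum_type[OF assms] by (simp add: has_sum_reindex_bij_betw[OF bij_sum_decode])

text \<open>Interleaving the defining sequences shows that the normal functionals form a vector
  space.\<close>

lemma normal_fn_lincomb: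
  fixes x1 x2 :: "(nat, 'a::chilbert_space) ell2" and y1 y2 :: "(nat, 'b::chilbert_space) ell2"
  shows "\<exists>x y. \<forall>A\<in>bop. normal_fn x y A = normal_fn x1 y1 A + c * normal_fn x2 y2 A"
proof -
  define u where "u = case_sum (ell2_nth x1) (ell2_nth (c *\<^sub>C x2))"
  define v where "v = case_sum (ell2_nth y1) (ell2_nth y2)"
  have "(\<lambda>n. (norm (u (sum_decode n)))\<^sup>2) summable_on UNIV"
    unfolding summable_on_def
    by (rule exI, rule has_sum_interleave[where f="\<lambda>s. (norm (u s))\<^sup>2"])
      (unfold u_def sum.case, (rule has_sum_infsum[OF ell2_summable])+)
  then have u: "ell2_nth (Abs_ell2 (\<lambda>n. u (sum_decode n))) n = u (sum_decode n)" for n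
    by (rule Abs_ell2_nth)
  have "(\<lambda>n. (norm (v (sum_decode n)))\<^sup>2) summable_on UNIV"
    unfolding summable_on_def
    by (rule exI, rule has_sum_interleave[where f="\<lambda>s. (norm (v s))\<^sup>2"])
      (unfold v_def sum.case, (rule has_sum_infsum[OF ell2_summable])+)
  then have v: "ell2_nth (Abs_ell2 (\<lambda>n. v (sum_decode n))) n = v (sum_decode n)" for n
    by (rule Abs_ell2_nth)
  have "normal_fn (Abs_ell2 (\<lambda>n. u (sum_decode n))) (Abs_ell2 (\<lambda>n. v (sum_decode n))) A
      = normal_fn x1 y1 A + c * normal_fn x2 y2 A" if A: "A \<in> bop" for A
  proof -
    have "normal_fn (c *\<^sub>C x2) y2 A = c * normal_fn x2 y2 A"
      using A by (simp add: normal_fn_infsum scaleC_ell2_nth bop_scaleC cinner_scaleC_left infsum_cmult_right')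
    then have 2: "((\<lambda>n. cinner (A (u (Inr n))) (v (Inr n))) has_sum (c * normal_fn x2 y2 A)) UNIV"
      using normal_fn_has_sum[OF A, of "c *\<^sub>C x2" y2] by (simp add: u_def v_def)
    have 1: "((\<lambda>n. cinner (A (u (Inl n))) (v (Inl n))) has_sum normal_fn x1 y1 A) UNIV"
      using normal_fn_has_sum[OF A, of x1 y1] by (simp add: u_def v_def)
    show ?thesis
      using has_sum_interleave[where f="\<lambda>s. cinner (A (u s)) (v s)", OF 1 2]
        normal_fn_has_sum[OF A, of "Abs_ell2 (\<lambda>n. u (sum_decode n))" "Abs_ell2 (\<lambda>n. v (sum_decode n))"]
      unfolding u v by (metis has_sum_unique)
  qed
  then show ?thesis by blast
qed

text \<open>The double annihilator with respect to normal functionals. Unlike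
  \<open>wstar_span\<close>, it also makes sense for operators between two different spaces.\<close>

definition bipolar :: "('a::chilbert_space \<Rightarrow> 'b::chilbert_space) set \<Rightarrow> ('a \<Rightarrow> 'b) set" where
  "bipolar X = {A \<in> bop. \<forall>x y. (\<forall>B\<in>X. normal_fn x y B = 0) \<longrightarrow> normal_fn x y A = 0}"

lemma bipolarI:
  "A \<in> bop \<Longrightarrow> (\<And>x y. (\<And>B. B \<in> X \<Longrightarrow> normal_fn x y B = 0) \<Longrightarrow> normal_fn x y A = 0) \<Longrightarrow> A \<in> bipolar X"
  by (auto simp: bipolar_def)

lemma bipolar_bop: "A \<in> bipolar X \<Longrightarrow> A \<in> bop"
  by (simp add: bipolar_def)

lemma bipolar_base: "A \<in> X \<Longrightarrow> A \<in> bop \<Longrightarrow> A \<in> bipolar X"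
  by (simp add: bipolar_def)

text \<open>Monotonicity and idempotence in one: an inclusion of closures need only be checked on
  generators.\<close>

lemma bipolar_subset_bipolar: "X \<subseteq> bipolar Y \<Longrightarrow> bipolar X \<subseteq> bipolar Y"
  by (auto simp: bipolar_def subset_iff)

lemma bipolar_zero: "(\<lambda>x. 0) \<in> bipolar X"
  by (rule bipolarI) (simp_all add: normal_fn_infsum)

lemma bipolar_plus: "A \<in> bipolar X \<Longrightarrow> B \<in> bipolar X \<Longrightarrow> (\<lambda>x. A x + B x) \<in> bipolar X"
  by (auto simp: bipolar_def bop_plus normal_fn_plus)

lemma bipolar_scale: "A \<in> bipolar X \<Longrightarrow> (\<lambda>x. c *\<^sub>C A x) \<in> bipolar X"
  by (auto simp: bipolar_def bop_scale normal_fn_scale)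

lemma bipolar_sub:
  assumes "A \<in> bipolar X" "B \<in> bipolar X" shows "(\<lambda>x. A x - B x) \<in> bipolar X"
proof -
  have "(\<lambda>x. A x - B x) = (\<lambda>x. A x + (-1) *\<^sub>C B x)"
    by (simp add: scaleC_minus_one)
  moreover have "(\<lambda>x. (-1) *\<^sub>C B x) \<in> bipolar X"
    by (rule bipolar_scale) fact
  ultimately show ?thesis
    using bipolar_plus[OF assms(1)] by simp
qed

text \<open>A functional vanishing on \<open>Y\<close> pulls back along \<open>L\<close> and
  \<open>R\<close> to one vanishing on \<open>X\<close>, hence at \<open>A\<close>. Through this,
  claims about products with an element of a closure reduce to its generators.\<close>

lemma bipolar_comp:
  assumes A: "A \<in> bipolar X" and L: "L \<in> bop" and R: "R \<in> bop" and X: "X \<subseteq> bop"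
    and *: "\<And>B. B \<in> X \<Longrightarrow> (\<lambda>v. L (B (R v))) \<in> bipolar Y"
  shows "(\<lambda>v. L (A (R v))) \<in> bipolar Y"
proof (rule bipolarI)
  show "(\<lambda>v. L (A (R v))) \<in> bop"
    by (rule bop_comp[OF L bop_comp[OF bipolar_bop[OF A] R]])
  fix x y assume 0: "\<And>B. B \<in> Y \<Longrightarrow> normal_fn x y B = 0"
  have "normal_fn (map_ell2 R x) (map_ell2 (adj L) y) B = 0" if "B \<in> X" for B
    using *[OF that] 0 normal_fn_comp[OF L _ R, of B x y] that X by (auto simp: bipolar_def)
  then have "normal_fn (map_ell2 R x) (map_ell2 (adj L) y) A = 0"
    using A by (auto simp: bipolar_def)
  then show "normal_fn x y (\<lambda>v. L (A (R v))) = 0"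
    using normal_fn_comp[OF L bipolar_bop[OF A] R] by simp
qed

lemma bipolar_adj:
  assumes A: "A \<in> bipolar X" and X: "X \<subseteq> bop" and *: "\<And>B. B \<in> X \<Longrightarrow> adj B \<in> bipolar Y"
  shows "adj A \<in> bipolar Y"
proof (rule bipolarI)
  show "adj A \<in> bop"
    using A by (intro bop_adj bipolar_bop)
  fix x y assume 0: "\<And>B. B \<in> Y \<Longrightarrow> normal_fn x y B = 0"
  have "normal_fn y x B = 0" if "B \<in> X" for B
    using *[OF that] 0 normal_fn_adj[of B x y] that X by (auto simp: bipolar_def)
  then have "normal_fn y x A = 0"
    using A by (auto simp: bipolar_def)
  then show "normal_fn x y (adj A) = 0"
    using normal_fn_adj[OF bipolar_bop[OF A]] by simp
qed

section \<open>Linear spans and their w*-closures\<close>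

lemma op_span_UNIV: "op_span UNIV X = {(\<lambda>x. \<Sum>i<n. c i *\<^sub>C A i x) |(n::nat) c A. \<forall>i<n. A i \<in> X}"
  by (simp add: op_span_def restrict_UNIV)

lemma op_span_zero: "(\<lambda>x. 0) \<in> op_span UNIV X"
  unfolding op_span_UNIV by (rule CollectI, rule exI[of _ 0]) simp

lemma op_span_plus1:
  assumes "L \<in> op_span UNIV X" "B \<in> X"
  shows "(\<lambda>x. L x + d *\<^sub>C B x) \<in> op_span UNIV X"
proof -
  obtain n :: nat and c A where L: "L = (\<lambda>x. \<Sum>i<n. c i *\<^sub>C A i x)" and A: "\<forall>i<n. A i \<in> X"
    using assms(1) unfolding op_span_UNIV by blast
  have "(\<lambda>x. L x + d *\<^sub>C B x) = (\<lambda>x. \<Sum>i<Suc n. (c(n := d)) i *\<^sub>C (A(n := B)) i x)"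
    by (simp add: L)
  then show ?thesis
    unfolding op_span_UNIV using A assms(2)
    by (intro CollectI exI[of _ "Suc n"] exI[of _ "c(n := d)"] exI[of _ "A(n := B)"])
      (auto simp: less_Suc_eq)
qed

lemma op_span_base: "B \<in> X \<Longrightarrow> B \<in> op_span UNIV X"
  using op_span_plus1[OF op_span_zero, of B X 1] by simp

lemma op_span_lincomb:
  assumes L: "L \<in> op_span UNIV X" and M: "M \<in> op_span UNIV X"
  shows "(\<lambda>x. L x + d *\<^sub>C M x) \<in> op_span UNIV X"
proof -
  obtain n :: nat and c A where M: "M = (\<lambda>x. \<Sum>i<n. c i *\<^sub>C A i x)" and A: "\<forall>i<n. A i \<in> X"
    using M unfolding op_span_UNIV by blast
  have "(\<lambda>x. L x + d *\<^sub>C (\<Sum>i<n. c i *\<^sub>C A i x)) \<in> op_span UNIV X"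
    using A
  proof (induction n)
    case (Suc n)
    then have "(\<lambda>x. (L x + d *\<^sub>C (\<Sum>i<n. c i *\<^sub>C A i x)) + (d * c n) *\<^sub>C A n x) \<in> op_span UNIV X"
      by (intro op_span_plus1[where L="\<lambda>x. L x + d *\<^sub>C (\<Sum>i<n. c i *\<^sub>C A i x)"]) simp_all
    then show ?case
      by (simp add: scaleC_add_right scaleC_scaleC add.assoc)
  qed (use L in simp)
  then show ?thesis
    by (simp add: M)
qed

lemma op_span_subset_bipolar:
  assumes "X \<subseteq> bop" shows "op_span UNIV X \<subseteq> bipolar X"
proof
  fix L assume "L \<in> op_span UNIV X"
  then obtain n :: nat and c A where L: "L = (\<lambda>x. \<Sum>i<n. c i *\<^sub>C A i x)" and A: "\<forall>i<n. A i \<in> X"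
    unfolding op_span_UNIV by blast
  have "(\<lambda>x. \<Sum>i<n. c i *\<^sub>C A i x) \<in> bipolar X"
    using A
  proof (induction n)
    case (Suc n)
    then have "(\<lambda>x. (\<Sum>i<n. c i *\<^sub>C A i x) + c n *\<^sub>C A n x) \<in> bipolar X"
      using assms by (intro bipolar_plus bipolar_scale) (auto intro: bipolar_base)
    then show ?case
      by simp
  qed (simp add: bipolar_zero)
  then show "L \<in> bipolar X"
    by (simp add: L)
qed

text \<open>Finitely many normal functionals cannot separate an operator of the bipolar from the
  span: eliminate one functional at a time.\<close>

lemma bipolar_interpolate:
  fixes X :: "('a::chilbert_space \<Rightarrow> 'b::chilbert_space) set"
  assumes X: "X \<subseteq> bop" and A: "A \<in> bipolar X"
  shows "\<exists>B\<in>op_span UNIV X. \<forall>k<(n::nat). normal_fn (x k) (y k) B = normal_fn (x k) (y k) A"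
proof (induction n arbitrary: x y)
  case 0
  then show ?case using op_span_zero by blast
next
  case (Suc n)
  note bop_span = op_span_subset_bipolar[OF X, THEN subsetD, THEN bipolar_bop]
  have Abop: "A \<in> bop" by (rule bipolar_bop[OF A])
  show ?case
  proof (cases "\<forall>B\<in>op_span UNIV X. normal_fn (x n) (y n) B = 0")
    case True
    then have "\<forall>B\<in>X. normal_fn (x n) (y n) B = 0"
      by (simp add: op_span_base)
    then have "normal_fn (x n) (y n) A = 0"
      using A by (simp add: bipolar_def)
    then show ?thesis
      using True Suc[of x y] by (auto simp: less_Suc_eq)
  next
    case False
    then obtain B0 where B0: "B0 \<in> op_span UNIV X" and ne: "normal_fn (x n) (y n) B0 \<noteq> 0"
      by blast
    \<comment> \<open>Adding \<open>c k\<close> times the last functional to the \<open>k\<close>-th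
      makes it vanish at \<open>B0\<close>. A multiple of \<open>B0\<close> can then correct the
      last value without disturbing the modified ones.\<close>
    define c where "c k = - (normal_fn (x k) (y k) B0 / normal_fn (x n) (y n) B0)" for k
    have "\<forall>k. \<exists>x' y'. \<forall>A\<in>bop. normal_fn x' y' A = normal_fn (x k) (y k) A + c k * normal_fn (x n) (y n) A"
      using normal_fn_lincomb by blast
    then obtain x' y' where
      xy': "\<And>k A. A \<in> bop \<Longrightarrow> normal_fn (x' k) (y' k) A = normal_fn (x k) (y k) A + c k * normal_fn (x n) (y n) A"
      by metis
    obtain B where B: "B \<in> op_span UNIV X" and eq: "\<forall>k<n. normal_fn (x' k) (y' k) B = normal_fn (x' k) (y' k) A"
      using Suc by blast
    define d where "d = (normal_fn (x n) (y n) A - normal_fn (x n) (y n) B) / normal_fn (x n) (y n) B0"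
    define B' where "B' = (\<lambda>v. B v + d *\<^sub>C B0 v)"
    have B': "normal_fn u w B' = normal_fn u w B + d * normal_fn u w B0" for u w
      unfolding B'_def using bop_span B B0 by (simp add: normal_fn_plus normal_fn_scale bop_scale)
    have last: "normal_fn (x n) (y n) B' = normal_fn (x n) (y n) A"
      using ne by (simp add: B' d_def)
    have "normal_fn (x k) (y k) B' = normal_fn (x k) (y k) A" if "k < n" for k
    proof -
      have "normal_fn (x k) (y k) B + c k * normal_fn (x n) (y n) B = normal_fn (x k) (y k) A + c k * normal_fn (x n) (y n) A"
        using eq that xy' bop_span[OF B] Abop by simp
      then show ?thesis
        using ne by (simp add: B' d_def c_def field_simps)
    qed
    then have "\<forall>k<Suc n. normal_fn (x k) (y k) B' = normal_fn (x k) (y k) A"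
      using last by (simp add: less_Suc_eq)
    moreover have "B' \<in> op_span UNIV X"
      unfolding B'_def by (rule op_span_lincomb[OF B B0])
    ultimately show ?thesis by blast
  qed
qed

lemma normal_fn_Abs_ell2:
  assumes "summable (\<lambda>n. (norm (x n))\<^sup>2)" "summable (\<lambda>n. (norm (y n))\<^sup>2)" "A \<in> bop"
  shows "normal_fn (Abs_ell2 x) (Abs_ell2 y) A = (\<Sum>n. cinner (A (x n)) (y n))"
proof -
  have "ell2_nth (Abs_ell2 x) n = x n" "ell2_nth (Abs_ell2 y) n = y n" for n
    using assms by (auto intro!: Abs_ell2_nth simp: summable_on_UNIV_nonneg_real_iff)
  then show ?thesis
    using has_sum_imp_sums[OF normal_fn_has_sum[OF assms(3), of "Abs_ell2 x" "Abs_ell2 y"]]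
    by (simp add: sums_iff)
qed

lemma wstar_topology_UNIV:
  "wstar_topology (UNIV :: 'a::chilbert_space set)
    = topology_generated_by {{A \<in> bop. normal_fn x y A \<in> G} |(x :: (nat, 'a) ell2) (y :: (nat, 'a) ell2) G. open G}" (is "_ = topology_generated_by ?S")
proof -
  let ?S' = "{{A \<in> bop. (\<Sum>n. cinner (A (x n)) (y n)) \<in> G} |(x :: nat \<Rightarrow> 'a) (y :: nat \<Rightarrow> 'a) G.
        range x \<subseteq> UNIV \<and> range y \<subseteq> UNIV \<and>
        summable (\<lambda>n. (norm (x n))\<^sup>2) \<and> summable (\<lambda>n. (norm (y n))\<^sup>2) \<and> open G}"
  have "?S' \<subseteq> ?S"
  proof
    fix Q assume "Q \<in> ?S'"
    then obtain x y G where Q: "Q = {A \<in> bop. (\<Sum>n. cinner (A (x n)) (y n)) \<in> G}" "open G"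
      and s: "summable (\<lambda>n. (norm (x n))\<^sup>2)" "summable (\<lambda>n. (norm (y n))\<^sup>2)"
      by blast
    have "Q = {A \<in> bop. normal_fn (Abs_ell2 x) (Abs_ell2 y) A \<in> G}"
      unfolding Q using normal_fn_Abs_ell2[OF s] by auto
    then show "Q \<in> ?S" using Q(2) by blast
  qed
  moreover have "?S \<subseteq> ?S'"
  proof
    fix Q assume "Q \<in> ?S"
    then obtain x y G where Q: "Q = {A \<in> bop. normal_fn x y A \<in> G}" "open G"
      by blast
    have s: "summable (\<lambda>n. (norm (ell2_nth x n))\<^sup>2)" "summable (\<lambda>n. (norm (ell2_nth y n))\<^sup>2)"
      using ell2_summable[of x] ell2_summable[of y] by (simp_all add: summable_on_UNIV_nonneg_real_iff)
    have "Q = {A \<in> bop. (\<Sum>n. cinner (A (ell2_nth x n)) (ell2_nth y n)) \<in> G}"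
      unfolding Q using normal_fn_Abs_ell2[OF s] by (auto simp: ell2_nth_inverse)
    then show "Q \<in> ?S'" using Q(2) s by blast
  qed
  ultimately show ?thesis
    unfolding wstar_topology_def by (simp add: subset_antisym)
qed

text \<open>A generating set restricts one functional, and an intersection concatenates two finite
  lists. Exact agreement with \<open>A\<close> replaces closeness, because
  \<open>bipolar_interpolate\<close> attains the values exactly.\<close>

lemma wstar_open_neighbourhood:
  fixes A :: "'a::chilbert_space \<Rightarrow> 'a"
  assumes "generate_topology_on
      {{A \<in> bop. normal_fn x y A \<in> G} |(x :: (nat, 'a) ell2) (y :: (nat, 'a) ell2) G. open G} Q" "A \<in> Q"
  shows "\<exists>(n::nat) (x :: nat \<Rightarrow> (nat, 'a) ell2) (y :: nat \<Rightarrow> (nat, 'a) ell2). \<forall>B\<in>bop. (\<forall>k<n. normal_fn (x k) (y k) B = normal_fn (x k) (y k) A) \<longrightarrow> B \<in> Q"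
  using assms
proof (induction rule: generate_topology_on.induct)
  case (Int P Q)
  then obtain n :: nat and x y where
    P: "\<forall>B\<in>bop. (\<forall>k<n. normal_fn (x k) (y k) B = normal_fn (x k) (y k) A) \<longrightarrow> B \<in> P"
    by blast
  from Int obtain m :: nat and u v where
    Q: "\<forall>B\<in>bop. (\<forall>k<m. normal_fn (u k) (v k) B = normal_fn (u k) (v k) A) \<longrightarrow> B \<in> Q"
    by blast
  define x' y' where "x' k = (if k < n then x k else u (k - n))"
    and "y' k = (if k < n then y k else v (k - n))" for k
  have "B \<in> P \<inter> Q" if B: "B \<in> bop"
    and eq: "\<forall>k<n + m. normal_fn (x' k) (y' k) B = normal_fn (x' k) (y' k) A" for B
  proof -
    have "normal_fn (x k) (y k) B = normal_fn (x k) (y k) A" if "k < n" for k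
      using eq[rule_format, of k] that by (simp add: x'_def y'_def)
    moreover have "normal_fn (u k) (v k) B = normal_fn (u k) (v k) A" if "k < m" for k
      using eq[rule_format, of "n + k"] that by (simp add: x'_def y'_def)
    ultimately show ?thesis using P Q B by blast
  qed
  then show ?case by blast
next
  case (UN K)
  then obtain k where k: "k \<in> K" "A \<in> k" by blast
  then obtain n :: nat and x y where
    "\<forall>B\<in>bop. (\<forall>i<n. normal_fn (x i) (y i) B = normal_fn (x i) (y i) A) \<longrightarrow> B \<in> k"
    using UN.IH by blast
  then show ?case using k(1) by blast
next
  case (Basis s)
  then obtain x y G where s: "s = {A \<in> bop. normal_fn x y A \<in> G}" by blast
  have "\<forall>B\<in>bop. (\<forall>k<Suc 0. normal_fn x y B = normal_fn x y A) \<longrightarrow> B \<in> s"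
    using Basis s by auto
  then show ?case
    by (intro exI[of _ "Suc 0"] exI[of _ "\<lambda>_. x"] exI[of _ "\<lambda>_. y"])
qed simp

text \<open>A functional that vanishes on \<open>X\<close> vanishes on the span, and its
  nonvanishing set is open, so it vanishes on the closure. Conversely, each neighbourhood of
  \<open>A\<close> contains all operators agreeing with \<open>A\<close> on finitely many
  functionals, and interpolation finds one of them in the span.\<close>

theorem wstar_span_eq_bipolar:
  fixes X :: "('a::chilbert_space \<Rightarrow> 'a) set"
  assumes X: "X \<subseteq> bop"
  shows "wstar_span UNIV X = bipolar X"
proof (rule subset_antisym; rule subsetI)
  fix A assume "A \<in> wstar_span UNIV X"
  then have A: "A \<in> topspace (wstar_topology UNIV)"
    and meets: "\<And>Q. openin (wstar_topology UNIV) Q \<Longrightarrow> A \<in> Q \<Longrightarrow> \<exists>B\<in>op_span UNIV X. B \<in> Q"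
    unfolding wstar_span_def in_closure_of by auto
  have Abop: "A \<in> bop"
    using A unfolding wstar_topology_UNIV by auto
  show "A \<in> bipolar X"
  proof (rule bipolarI[OF Abop], rule ccontr)
    fix x y assume 0: "\<And>B. B \<in> X \<Longrightarrow> normal_fn x y B = 0" and ne: "normal_fn x y A \<noteq> 0"
    have "openin (wstar_topology UNIV) {A \<in> bop. normal_fn x y A \<in> - {0}}"
      unfolding wstar_topology_UNIV by (rule topology_generated_by_Basis) blast
    then obtain B where "B \<in> op_span UNIV X" "normal_fn x y B \<noteq> 0"
      using meets[of "{A \<in> bop. normal_fn x y A \<in> - {0}}"] Abop ne by blast
    then show False
      using 0 op_span_subset_bipolar[OF X] by (auto simp: bipolar_def)
  qed
next
  fix A assume A: "A \<in> bipolar X"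
  have "UNIV = (\<lambda>A. normal_fn 0 0 A) -` UNIV" by simp
  \<comment> \<open>Zero vectors and \<open>G = UNIV\<close> exhibit \<open>bop\<close> itself as a
    generating set, which puts \<open>A\<close> in the underlying set of the topology.\<close>
  have "bop \<in> {{A \<in> bop. normal_fn x y A \<in> G} |(x::(nat,'a) ell2) (y::(nat,'a) ell2) G. open G}"
    by (rule CollectI, rule exI[of _ 0], rule exI[of _ 0], rule exI[of _ UNIV]) simp
  then have top: "A \<in> topspace (wstar_topology UNIV)"
    unfolding wstar_topology_UNIV topology_generated_by_topspace using bipolar_bop[OF A] by blast
  show "A \<in> wstar_span UNIV X"
    unfolding wstar_span_def in_closure_of
  proof (intro conjI top allI impI)
    fix Q assume Q: "A \<in> Q \<and> openin (wstar_topology UNIV) Q"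
    then obtain n :: nat and x y where
      *: "\<forall>B\<in>bop. (\<forall>k<n. normal_fn (x k) (y k) B = normal_fn (x k) (y k) A) \<longrightarrow> B \<in> Q"
      using wstar_open_neighbourhood[of Q A]
      unfolding wstar_topology_UNIV openin_topology_generated_by_iff by blast
    obtain B where "B \<in> op_span UNIV X" "\<forall>k<n. normal_fn (x k) (y k) B = normal_fn (x k) (y k) A"
      using bipolar_interpolate[OF X A] by blast
    then show "\<exists>B. B \<in> op_span UNIV X \<and> B \<in> Q"
      using * op_span_subset_bipolar[OF X] bipolar_bop by blast
  qed
qed

section \<open>Matrix units and amplifications\<close>

definition single :: "'i \<Rightarrow> 'a::chilbert_space \<Rightarrow> ('i, 'a) ell2" where
  "single i h = Abs_ell2 (\<lambda>j. if j = i then h else 0)"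

lemma single_nth: "ell2_nth (single i h) j = (if j = i then h else 0)"
  unfolding single_def
proof (rule Abs_ell2_nth)
  have "(\<lambda>j. (norm (if j = i then h else 0))\<^sup>2) summable_on {i}"
    by (rule summable_on_finite) simp
  then show "(\<lambda>j. (norm (if j = i then h else 0))\<^sup>2) summable_on UNIV"
    by (rule summable_on_cong_neutral[THEN iffD1, rotated -1]) auto
qed

lemma cinner_single_left: "cinner (single i h) f = cinner h (ell2_nth f i)"
proof -
  have "cinner (single i h) f = (\<Sum>\<^sub>\<infinity>j\<in>{i}. cinner h (ell2_nth f j))"
    unfolding cinner_ell2_def by (rule infsum_cong_neutral) (auto simp: single_nth)
  then show ?thesis by simp
qed

lemma cinner_single_right: "cinner f (single i h) = cinner (ell2_nth f i) h"
  by (metis cinner_single_left cinner_commute)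

lemma bop_nth: "(\<lambda>f. ell2_nth f i) \<in> bop"
  by (rule bopI[where B=1]) (auto simp: plus_ell2_nth scaleC_ell2_nth norm_ell2_nth_le)

lemma norm_single: "norm (single i h) = norm h"
proof -
  have "complex_of_real ((norm (single i h))\<^sup>2) = complex_of_real ((norm h)\<^sup>2)"
    by (simp only: cinner_self[symmetric] cinner_single_left single_nth if_True refl)
  then show ?thesis
    unfolding of_real_eq_iff by (simp add: power2_eq_iff_nonneg)
qed

lemma bop_single: "single i \<in> bop"
  by (rule bopI[where B=1])
    (auto intro!: ell2_eqI simp: plus_ell2_nth scaleC_ell2_nth single_nth norm_single)

lemma adj_single: "adj (single i) = (\<lambda>f. ell2_nth f i)"
  by (rule adjoint_unique) (auto simp: bop_nth cinner_single_left)

lemma adj_nth: "adj (\<lambda>f. ell2_nth f i) = single i"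
  by (rule adjoint_unique) (auto simp: bop_single cinner_single_right)

text \<open>The operator \<open>s \<otimes> e\<^sub>i\<^sub>j\<close>; row and column index types
  may differ, as may the two Hilbert spaces.\<close>

definition matrix_unit :: "'i \<Rightarrow> 'j \<Rightarrow> ('a::chilbert_space \<Rightarrow> 'b::chilbert_space) \<Rightarrow> ('j, 'a) ell2 \<Rightarrow> ('i, 'b) ell2" where
  "matrix_unit i j s = (\<lambda>f. single i (s (ell2_nth f j)))"

lemma bop_matrix_unit: "s \<in> bop \<Longrightarrow> matrix_unit i j s \<in> bop"
  unfolding matrix_unit_def by (rule bop_comp[OF bop_single bop_comp[OF _ bop_nth]])

lemma adj_matrix_unit: "s \<in> bop \<Longrightarrow> adj (matrix_unit i j s) = matrix_unit j i (adj s)"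
  unfolding matrix_unit_def
  by (simp add: adj_comp[OF bop_single bop_comp[OF _ bop_nth]] adj_comp[OF _ bop_nth]
      adj_single adj_nth)

text \<open>Only matrices with at most one nonzero entry are collected; all other bounded matrices
  with entries from \<open>X\<close> enter through the bipolar, by
  \<open>bipolar_matrix_unitsI\<close>.\<close>

definition matrix_units :: "('a::chilbert_space \<Rightarrow> 'b::chilbert_space) set \<Rightarrow> (('j, 'a) ell2 \<Rightarrow> ('i, 'b) ell2) set" where
  "matrix_units X = {matrix_unit i j s |i j s. s \<in> X}"

lemma matrix_units_bop: "X \<subseteq> bop \<Longrightarrow> matrix_units X \<subseteq> bop"
  by (auto simp: matrix_units_def intro: bop_matrix_unit)

lemma matrix_unit_bipolar:
  assumes "X \<subseteq> bop" "s \<in> bipolar X" shows "matrix_unit i j s \<in> bipolar (matrix_units X)"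
  unfolding matrix_unit_def
proof (rule bipolar_comp[OF assms(2) bop_single bop_nth assms(1)])
  fix B assume "B \<in> X"
  then have "matrix_unit i j B \<in> bipolar (matrix_units X)"
    using assms(1) by (intro bipolar_base bop_matrix_unit) (auto simp: matrix_units_def)
  then show "(\<lambda>v. single i (B (ell2_nth v j))) \<in> bipolar (matrix_units X)"
    by (simp add: matrix_unit_def)
qed

lemma square_summable_double:
  fixes x :: "('n, ('i, 'a::chilbert_space) ell2) ell2"
  shows "(\<lambda>(n, i). (norm (ell2_nth (ell2_nth x n) i))\<^sup>2) summable_on UNIV \<times> UNIV"
proof (rule summable_on_SigmaI[where g = "\<lambda>n. (norm (ell2_nth x n))\<^sup>2"])
  show "((\<lambda>i. case (n, i) of (n, i) \<Rightarrow> (norm (ell2_nth (ell2_nth x n) i))\<^sup>2) has_sum (norm (ell2_nth x n))\<^sup>2) UNIV" for n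
    using has_sum_infsum[OF ell2_summable[of "ell2_nth x n"]] by (simp add: norm_ell2_square)
qed (auto simp: ell2_summable)

text \<open>Fubini: a normal functional evaluated at the identity is the sum of its values at the
  coordinate projections.\<close>

lemma id_bipolar_coordinates:
  "(\<lambda>f :: ('i, 'a::chilbert_space) ell2. f) \<in> bipolar {\<lambda>f. single i (ell2_nth f i) |i. True}"
proof (rule bipolarI[OF bop_id])
  fix x y :: "(nat, ('i, 'a) ell2) ell2"
  assume 0: "normal_fn x y B = 0" if "B \<in> {\<lambda>f. single i (ell2_nth f i) |i. True}" for B
  let ?c = "\<lambda>n i. cinner (ell2_nth (ell2_nth x n) i) (ell2_nth (ell2_nth y n) i)"
  have "(\<lambda>p. norm (case p of (n, i) \<Rightarrow> ?c n i)) summable_on UNIV \<times> UNIV"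
  proof (rule summable_on_comparison_test)
    show "(\<lambda>p. (case p of (n, i) \<Rightarrow> (norm (ell2_nth (ell2_nth x n) i))\<^sup>2)
        + (case p of (n, i) \<Rightarrow> (norm (ell2_nth (ell2_nth y n) i))\<^sup>2)) summable_on UNIV \<times> UNIV"
      by (intro summable_on_add square_summable_double)
    have "cmod (cinner v w) \<le> (norm v)\<^sup>2 + (norm w)\<^sup>2" for v w :: 'a
      using norm_cinner_le[of v w] sum_squares_bound[of "norm v" "norm w"]
        mult_nonneg_nonneg[OF norm_ge_zero[of v] norm_ge_zero[of w]] by linarith
    then show "norm (case p of (n, i) \<Rightarrow> ?c n i) \<le> (case p of (n, i) \<Rightarrow> (norm (ell2_nth (ell2_nth x n) i))\<^sup>2)
        + (case p of (n, i) \<Rightarrow> (norm (ell2_nth (ell2_nth y n) i))\<^sup>2)" for p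
      by (cases p) simp
  qed simp
  then have summ: "(\<lambda>(n, i). ?c n i) summable_on UNIV \<times> UNIV"
    by (rule abs_summable_summable)
  have "normal_fn x y (\<lambda>f. f) = (\<Sum>\<^sub>\<infinity>n. \<Sum>\<^sub>\<infinity>i. ?c n i)"
    by (simp add: normal_fn_infsum cinner_ell2_def[where f="ell2_nth x _"])
  also have "\<dots> = (\<Sum>\<^sub>\<infinity>i. \<Sum>\<^sub>\<infinity>n. ?c n i)"
    by (rule infsum_swap_banach[OF summ])
  finally have eq: "normal_fn x y (\<lambda>f. f) = (\<Sum>\<^sub>\<infinity>i. \<Sum>\<^sub>\<infinity>n. ?c n i)" .
  have "(\<Sum>\<^sub>\<infinity>n. ?c n i) = 0" for i
  proof -
    have "normal_fn x y (\<lambda>f. single i (ell2_nth f i)) = (\<Sum>\<^sub>\<infinity>n. ?c n i)"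
      by (simp add: normal_fn_infsum[OF bop_comp[OF bop_single bop_nth]] cinner_single_left)
    then show ?thesis
      using 0[of "\<lambda>f. single i (ell2_nth f i)"] by auto
  qed
  then show "normal_fn x y (\<lambda>f. f) = 0"
    by (simp add: eq)
qed

lemma coordinates_bop: "{\<lambda>f. single i (ell2_nth f i) |i. True} \<subseteq> bop"
  by (auto intro: bop_comp[OF bop_single bop_nth])

text \<open>The identity between \<open>R\<close> and \<open>L\<close> is resolved into coordinate
  projections. This takes the place of any convergence argument for infinite matrix
  products.\<close>

lemma bipolar_insert_id:
  fixes L :: "('i, 'a::chilbert_space) ell2 \<Rightarrow> 'c::chilbert_space" and R :: "'b::chilbert_space \<Rightarrow> ('i, 'a) ell2"
  assumes L: "L \<in> bop" and R: "R \<in> bop"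
    and *: "\<And>i. (\<lambda>v. L (single i (ell2_nth (R v) i))) \<in> bipolar Y"
  shows "(\<lambda>v. L (R v)) \<in> bipolar Y"
proof (rule bipolar_comp[OF id_bipolar_coordinates L R coordinates_bop])
  fix B :: "('i, 'a) ell2 \<Rightarrow> ('i, 'a) ell2"
  assume "B \<in> {\<lambda>f. single i (ell2_nth f i) |i. True}"
  then show "(\<lambda>v. L (B (R v))) \<in> bipolar Y"
    using * by auto
qed

text \<open>Resolving the identity to the left of \<open>A\<close> isolates a row, resolving it to
  the right isolates a column; what remains is a matrix unit.\<close>

lemma bipolar_matrix_unitsI:
  fixes A :: "('j, 'a::chilbert_space) ell2 \<Rightarrow> ('i, 'b::chilbert_space) ell2"
  assumes A: "A \<in> bop" and X: "X \<subseteq> bop"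
    and entries: "\<And>i j. (\<lambda>h. ell2_nth (A (single j h)) i) \<in> bipolar X"
  shows "A \<in> bipolar (matrix_units X)"
proof -
  have "(\<lambda>v. A v) \<in> bipolar (matrix_units X)"
  proof (rule bipolar_insert_id[OF bop_id A])
    fix i
    have L: "(\<lambda>v. single i (ell2_nth (A v) i)) \<in> bop"
      by (rule bop_comp[OF bop_single bop_comp[OF bop_nth A]])
    show "(\<lambda>v. single i (ell2_nth (A v) i)) \<in> bipolar (matrix_units X)"
    proof (rule bipolar_insert_id[OF L bop_id])
      fix j
      show "(\<lambda>v. single i (ell2_nth (A (single j (ell2_nth v j))) i)) \<in> bipolar (matrix_units X)"
        using matrix_unit_bipolar[OF X entries[where i=i and j=j], where i=i and j=j] unfolding matrix_unit_def .
    qed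
  qed
  then show ?thesis by simp
qed

section \<open>Amplifications as bipolars of matrix units\<close>

lemma ell2_on_UNIV [simp]: "ell2_on UNIV = UNIV"
  by (simp add: ell2_on_def)

lemma op_subspace_scale: "op_subspace UNIV UNIV S \<Longrightarrow> s \<in> S \<Longrightarrow> (\<lambda>x. c *\<^sub>C s x) \<in> S"
  by (simp add: op_subspace_def restrict_UNIV)

text \<open>Every entry of \<open>s \<otimes> a\<close> is a scalar multiple of \<open>s\<close>,
  and conversely each matrix unit over \<open>S\<close> is an elementary tensor of \<open>s\<close>
  with a scalar matrix unit.\<close>

lemma amplification_UNIV:
  fixes S :: "('a::chilbert_space \<Rightarrow> 'a) set"
  assumes S: "op_subspace UNIV UNIV S"
  shows "amplification S (UNIV :: 'j set) = bipolar (matrix_units S)"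
proof -
  let ?T = "{A. \<exists>s\<in>S. \<exists>a\<in>bop. is_tensor_op (UNIV :: 'j set) s a A}"
  have Sbop: "S \<subseteq> bop"
    using S by (simp add: op_subspace_def)
  have Tbop: "?T \<subseteq> bop"
    by (auto simp: is_tensor_op_def)
  have "?T \<subseteq> bipolar (matrix_units S)"
  proof
    fix A assume "A \<in> ?T"
    then obtain s a where s: "s \<in> S" and A: "A \<in> bop"
      and tensor: "\<And>h x. A (ell2_tensor h x) = ell2_tensor (s h) (a x)"
      by (auto simp: is_tensor_op_def)
    show "A \<in> bipolar (matrix_units S)"
    proof (rule bipolar_matrix_unitsI[OF A Sbop])
      fix i j :: 'j
      \<comment> \<open>Vectors concentrated in one coordinate are elementary tensors, so the tensor
        condition determines the entries of \<open>A\<close>.\<close>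
      have "single j h = ell2_tensor h (single j 1)" for h :: 'a
        by (rule ell2_eqI) (simp add: single_nth ell2_tensor_nth)
      then have "(\<lambda>h. ell2_nth (A (single j h)) i) = (\<lambda>h. ell2_nth (a (single j 1)) i *\<^sub>C s h)"
        by (simp add: tensor ell2_tensor_nth)
      also have "\<dots> \<in> bipolar S"
        using op_subspace_scale[OF S s] Sbop by (blast intro: bipolar_base)
      finally show "(\<lambda>h. ell2_nth (A (single j h)) i) \<in> bipolar S" .
    qed
  qed
  moreover have "matrix_units S \<subseteq> ?T"
  proof
    fix A :: "('j, 'a) ell2 \<Rightarrow> ('j, 'a) ell2" assume "A \<in> matrix_units S"
    then obtain i j s where s: "s \<in> S" and A: "A = matrix_unit i j s"
      by (auto simp: matrix_units_def)
    have "is_tensor_op UNIV s (matrix_unit i j (\<lambda>z. z)) A"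
      unfolding is_tensor_op_def A matrix_unit_def[of i j]
    proof (simp, intro conjI allI)
      show "(\<lambda>f. single i (s (ell2_nth f j))) \<in> bop"
        using bop_matrix_unit[of s i j] s Sbop by (auto simp: matrix_unit_def)
      show "single i (s (ell2_nth (ell2_tensor h x) j)) = ell2_tensor (s h) (single i (ell2_nth x j))" for h x
        using s Sbop by (intro ell2_eqI) (auto simp: single_nth ell2_tensor_nth intro: bop_scaleC)
    qed
    then show "A \<in> ?T"
      by (intro CollectI bexI[of _ s] bexI[of _ "matrix_unit i j (\<lambda>z. z)"] s bop_matrix_unit bop_id)
  qed
  moreover have "?T \<subseteq> bipolar ?T"
    using Tbop by (simp add: subset_iff bipolar_base)
  ultimately have "bipolar ?T \<subseteq> bipolar (matrix_units S)" "bipolar (matrix_units S) \<subseteq> bipolar ?T"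
    by (simp_all add: bipolar_subset_bipolar order_trans[of "matrix_units S" ?T])
  then have "bipolar ?T = bipolar (matrix_units S)"
    by (rule subset_antisym)
  then show ?thesis
    unfolding amplification_def by (simp add: wstar_span_eq_bipolar[OF Tbop])
qed

section \<open>Columns of operators\<close>

definition column :: "('i \<Rightarrow> 'a::chilbert_space \<Rightarrow> 'b::chilbert_space) \<Rightarrow> 'a \<Rightarrow> ('i, 'b) ell2" where
  "column g h = Abs_ell2 (\<lambda>i. g i h)"

text \<open>The bound on finite sums expresses
  \<open>\<Sum>g\<^sub>i\<^sup>* g\<^sub>i \<le> 1\<close>; it makes the column well defined and
  contractive.\<close>

lemma
  assumes "\<And>i. g i \<in> bop" "\<And>F h. finite F \<Longrightarrow> (\<Sum>i\<in>F. (norm (g i h))\<^sup>2) \<le> (norm h)\<^sup>2"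
  shows column_nth: "ell2_nth (column g h) i = g i h"
    and norm_column: "norm (column g h) \<le> norm h"
    and bop_column: "column g \<in> bop"
proof -
  have summ: "(\<lambda>i. (norm (g i h))\<^sup>2) summable_on UNIV" for h
    using assms(2)[of _ h] by (intro nonneg_bdd_above_summable_on) (auto simp: bdd_above_def)
  show nth: "ell2_nth (column g h) i = g i h" for h i
    unfolding column_def by (rule Abs_ell2_nth[OF summ])
  show le: "norm (column g h) \<le> norm h" for h
  proof (rule power2_le_imp_le)
    show "(norm (column g h))\<^sup>2 \<le> (norm h)\<^sup>2"
      unfolding norm_ell2_square nth by (rule infsum_le_finite_sums[OF summ]) (use assms(2) in auto)
  qed simp
  show "column g \<in> bop"
    by (rule bopI[where B=1])
      (auto intro!: ell2_eqI simp: nth plus_ell2_nth scaleC_ell2_nth le bop_add[OF assms(1)] bop_scaleC[OF assms(1)])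
qed

lemma cinner_column_column:
  assumes "\<And>i. ell2_nth (G h) i = g i h" "\<And>i. ell2_nth (G k) i = g i k"
  shows "((\<lambda>i. cinner (g i h) (g i k)) has_sum cinner (G h) (G k)) UNIV"
  using has_sum_infsum[OF ell2_cinner_summable[of "G h" "G k"]] by (simp add: cinner_ell2_def assms)

section \<open>Isometric families in a ternary ring\<close>

text \<open>Multiplication is only separately w*-continuous, so the generators are replaced one
  factor at a time: first \<open>n\<close> by \<open>c\<close>, then \<open>m\<close> by
  \<open>b\<close>, then \<open>l\<close> by \<open>a\<close>.\<close>

lemma bipolar_triple:
  assumes X: "X \<subseteq> bop" and Y: "Y \<subseteq> bop" and Z: "Z \<subseteq> bop"
    and a: "a \<in> bipolar X" and b: "b \<in> bipolar Y" and c: "c \<in> bipolar Z"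
    and *: "\<And>l m n. l \<in> X \<Longrightarrow> m \<in> Y \<Longrightarrow> n \<in> Z \<Longrightarrow> (\<lambda>v. l (m (n v))) \<in> bipolar Q"
  shows "(\<lambda>v. a (b (c v))) \<in> bipolar Q"
proof -
  note cb = bipolar_bop[OF c] and bb = bipolar_bop[OF b]
  have 1: "(\<lambda>v. l (m (c v))) \<in> bipolar Q" if "l \<in> X" "m \<in> Y" for l m
    by (rule bipolar_comp[where L="\<lambda>v. l (m v)" and R="\<lambda>v. v", OF c _ bop_id Z])
      (use X Y that * in \<open>auto intro: bop_comp[of l m]\<close>)
  have 2: "(\<lambda>v. l (b (c v))) \<in> bipolar Q" if "l \<in> X" for l
    by (rule bipolar_comp[where L=l and R=c, OF b _ cb Y]) (use X that 1 in auto)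
  show ?thesis
    by (rule bipolar_comp[where L="\<lambda>v. v" and R="\<lambda>v. b (c v)", OF a bop_id bop_comp[OF bb cb] X])
      (rule 2)
qed

lemma bipolar_adj_image: "X \<subseteq> bop \<Longrightarrow> A \<in> bipolar X \<Longrightarrow> adj A \<in> bipolar (adj ` X)"
  by (rule bipolar_adj) (auto intro!: bipolar_base bop_adj)

lemma adj_image_bop: "X \<subseteq> bop \<Longrightarrow> adj ` X \<subseteq> bop"
  by (auto intro: bop_adj)

text \<open>A generating set for a w*-closed TRO: linearity is dropped and triple products need only
  land in the bipolar, so that \<open>matrix_units X\<close> qualifies as well.\<close>

definition ternary :: "('a::chilbert_space \<Rightarrow> 'b::chilbert_space) set \<Rightarrow> bool" where
  "ternary X \<longleftrightarrow> X \<subseteq> bop \<and> (\<forall>l\<in>X. \<forall>m\<in>X. \<forall>n\<in>X. (\<lambda>v. l (adj m (n v))) \<in> bipolar X)"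

lemma ternary_bipolar:
  assumes X: "ternary X" and "a \<in> bipolar X" "b \<in> bipolar X" "c \<in> bipolar X"
  shows "(\<lambda>v. a (adj b (c v))) \<in> bipolar X"
proof (rule bipolar_triple[of X "adj ` X" X])
  show "X \<subseteq> bop" "X \<subseteq> bop"
    using X by (auto simp: ternary_def)
  then show "adj ` X \<subseteq> bop" "adj b \<in> bipolar (adj ` X)"
    using assms(3) by (auto intro: bop_adj bipolar_adj_image)
qed (use assms in \<open>auto simp: ternary_def\<close>)

lemma matrix_unit_triple:
  assumes "l \<in> bop" "m \<in> bop" "n \<in> bop" "Q \<subseteq> bop" "(\<lambda>v. l (m (n v))) \<in> bipolar Q"
  shows "(\<lambda>f. matrix_unit i j l (matrix_unit k p m (matrix_unit r s n f))) \<in> bipolar (matrix_units Q)"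
proof (cases "j = k \<and> p = r")
  case True
  then have "(\<lambda>f. matrix_unit i j l (matrix_unit k p m (matrix_unit r s n f)))
      = matrix_unit i s (\<lambda>v. l (m (n v)))"
    by (simp add: matrix_unit_def single_nth)
  then show ?thesis
    using matrix_unit_bipolar[OF assms(4,5)] by simp
next
  case False
  then have "(\<lambda>f. matrix_unit i j l (matrix_unit k p m (matrix_unit r s n f))) = (\<lambda>f. 0)"
    by (auto simp: matrix_unit_def single_nth bop_zero[OF assms(1)] bop_zero[OF assms(2)]
        bop_zero[OF bop_single])
  then show ?thesis
    by (simp add: bipolar_zero)
qed

lemma ternary_matrix_units:
  fixes X :: "('a::chilbert_space \<Rightarrow> 'b::chilbert_space) set"
  assumes X: "ternary X"
  shows "ternary (matrix_units X :: (('j, 'a) ell2 \<Rightarrow> ('i, 'b) ell2) set)"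
proof -
  have Xbop: "X \<subseteq> bop" using X by (simp add: ternary_def)
  show ?thesis
    unfolding ternary_def
  proof (intro conjI ballI matrix_units_bop Xbop)
    fix a b c :: "('j, 'a) ell2 \<Rightarrow> ('i, 'b) ell2"
    assume "a \<in> matrix_units X" "b \<in> matrix_units X" "c \<in> matrix_units X"
    then obtain i j l k p m r s n where eq: "a = matrix_unit i j l" "b = matrix_unit p k m"
      "c = matrix_unit r s n" and lmn: "l \<in> X" "m \<in> X" "n \<in> X"
      unfolding matrix_units_def by blast
    have "l \<in> bop" "m \<in> bop" "n \<in> bop" "(\<lambda>v. l (adj m (n v))) \<in> bipolar X"
      using X lmn by (auto simp: ternary_def)
    then show "(\<lambda>v. a (adj b (c v))) \<in> bipolar (matrix_units X)"
      unfolding eq by (simp add: adj_matrix_unit matrix_unit_triple Xbop bop_adj)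
  qed
qed

lemma norm_adj_le:
  assumes T: "T \<in> bop" and le: "\<And>x. norm (T x) \<le> norm x"
  shows "norm (adj T y) \<le> norm y"
proof (cases "adj T y = 0")
  case False
  have "norm (adj T y) * norm (adj T y) = inner (T (adj T y)) y"
    by (simp add: Re_cinner[symmetric] cinner_adj_right[OF T, symmetric] cinner_self power2_eq_square)
  also have "\<dots> \<le> norm (adj T y) * norm y"
    by (rule order_trans[OF norm_cauchy_schwarz mult_right_mono[OF le]]) simp
  finally show ?thesis
    using False by simp
qed simp

text \<open>With \<open>C = T\<^sup>* T\<close> the claim reads
  \<open>(1 - C)\<^sup>2 + C \<le> 1\<close>, that is \<open>C\<^sup>2 \<le> C\<close>, which holds
  since \<open>adj T\<close> is contractive too.\<close>

lemma norm_defect_le: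
  assumes T: "T \<in> bop" and le: "\<And>x. norm (T x) \<le> norm x"
  shows "(norm (x - adj T (T x)))\<^sup>2 + (norm (T x))\<^sup>2 \<le> (norm x)\<^sup>2"
proof -
  have "inner x (adj T (T x)) = (norm (T x))\<^sup>2"
    by (simp add: Re_cinner[symmetric] cinner_adj_right[OF T] cinner_self)
  moreover have "(norm (adj T (T x)))\<^sup>2 \<le> (norm (T x))\<^sup>2"
    by (intro power_mono norm_adj_le T le norm_ge_zero)
  ultimately show ?thesis
    by (simp add: power2_norm_eq_inner inner_diff_left inner_diff_right inner_commute)
qed

text \<open>With \<open>G\<close> the column of the \<open>g\<^sub>i\<close>, the operator \<open>G\<^sup>* G\<close> is the strong sum of the
  \<open>g\<^sub>i\<^sup>* g\<^sub>i\<close>.\<close>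

lemma bipolar_comp_column:
  assumes N: "N \<in> bop" and G: "G \<in> bop" and nth: "\<And>i v. ell2_nth (G v) i = g i v"
    and *: "\<And>i. (\<lambda>v. N (adj (g i) (g i v))) \<in> bipolar Y"
  shows "(\<lambda>v. N (adj G (G v))) \<in> bipolar Y"
proof (rule bipolar_insert_id[OF bop_comp[OF N bop_adj[OF G]] G])
  fix i
  have "adj (\<lambda>v. ell2_nth (G v) i) = (\<lambda>k. adj G (single i k))"
    by (simp add: adj_comp[OF bop_nth G] adj_nth)
  then have "adj (g i) = (\<lambda>k. adj G (single i k))"
    by (simp add: nth)
  then show "(\<lambda>v. N (adj G (single i (ell2_nth (G v) i)))) \<in> bipolar Y"
    using *[of i] by (simp add: nth)
qed

text \<open>Take a maximal family with \<open>\<Sum>z\<^sup>* z \<le> 1\<close>. If \<open>R = 1 - \<Sum>z\<^sup>* z\<close> were nonzero, some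
  \<open>t m R\<close> could be added: for small \<open>t\<close> one has \<open>t\<^sup>2 R m\<^sup>* m R \<le> R\<^sup>2 \<le> R\<close>, and only countably
  many of these operators can already belong to the family.\<close>

lemma isometric_family_exists:
  fixes M :: "('a::chilbert_space \<Rightarrow> 'b::chilbert_space) set"
  assumes M: "ternary M" and nondeg: "\<And>h. h \<noteq> 0 \<Longrightarrow> \<exists>m\<in>M. m h \<noteq> 0"
  shows "\<exists>Z\<subseteq>bipolar M. (\<lambda>_. 0) \<notin> Z \<and> (\<forall>h. ((\<lambda>z. (norm (z h))\<^sup>2) has_sum (norm h)\<^sup>2) Z)"
proof -
  \<comment> \<open>Zero is excluded so that each member of the family can later be labelled by a
    vector at which it does not vanish.\<close>
  define P where "P = {Z. Z \<subseteq> bipolar M - {\<lambda>_. 0} \<and>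
    (\<forall>F\<subseteq>Z. finite F \<longrightarrow> (\<forall>h. (\<Sum>z\<in>F. (norm (z h))\<^sup>2) \<le> (norm h)\<^sup>2))}"
  have "\<exists>Z\<in>P. \<forall>Z'\<in>P. Z \<subseteq> Z' \<longrightarrow> Z' = Z"
  proof (rule subset_Zorn')
    fix C assume C: "subset.chain P C"
    then have CP: "C \<subseteq> P" by (auto simp: subset.chain_def)
    have "(\<Sum>z\<in>F. (norm (z h))\<^sup>2) \<le> (norm h)\<^sup>2" if F: "F \<subseteq> \<Union>C" "finite F" for F h
    proof (cases "C = {}")
      case False
      then obtain Z where "Z \<in> C" "F \<subseteq> Z"
        using finite_subset_Union_chain[OF F(2,1) False C] by blast
      then show ?thesis
        using CP F(2) unfolding P_def by blast
    qed (use F in simp)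
    moreover have "\<Union>C \<subseteq> bipolar M - {\<lambda>_. 0}"
      using CP unfolding P_def by blast
    ultimately show "\<Union>C \<in> P"
      unfolding P_def by blast
  qed
  then obtain Z where ZP: "Z \<in> P" and max: "\<And>Z'. Z' \<in> P \<Longrightarrow> Z \<subseteq> Z' \<Longrightarrow> Z' = Z"
    by blast
  have Z: "Z \<subseteq> bipolar M" "(\<lambda>_. 0) \<notin> Z"
    and le: "\<And>F h. F \<subseteq> Z \<Longrightarrow> finite F \<Longrightarrow> (\<Sum>z\<in>F. (norm (z h))\<^sup>2) \<le> (norm h)\<^sup>2"
    using ZP unfolding P_def by blast+
  \<comment> \<open>A column is indexed by a whole type, so the family is extended by zero to all
    functions.\<close>
  define g where "g z = (if z \<in> Z then z else (\<lambda>_. 0))" for z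
  define G where "G = column g"
  have g_bipolar: "g z \<in> bipolar M" for z
    using Z(1) by (auto simp: g_def bipolar_zero)
  have g_le: "(\<Sum>z\<in>F. (norm (g z h))\<^sup>2) \<le> (norm h)\<^sup>2" if "finite F" for F h
  proof -
    have "(\<Sum>z\<in>F. (norm (g z h))\<^sup>2) = (\<Sum>z\<in>F \<inter> Z. (norm (z h))\<^sup>2)"
      using that by (intro sum.mono_neutral_cong_right) (auto simp: g_def)
    then show ?thesis
      using le[of "F \<inter> Z" h] that by simp
  qed
  note col = column_nth[of g, OF bipolar_bop[OF g_bipolar] g_le, folded G_def]
    norm_column[of g, OF bipolar_bop[OF g_bipolar] g_le, folded G_def]
    bop_column[of g, OF bipolar_bop[OF g_bipolar] g_le, folded G_def]
  have G_sum: "((\<lambda>z. (norm (z h))\<^sup>2) has_sum (norm (G h))\<^sup>2) Z" for h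
  proof -
    have "((\<lambda>z. (norm (g z h))\<^sup>2) has_sum (norm (G h))\<^sup>2) UNIV"
      using has_sum_infsum[OF ell2_summable[of "G h"]] by (simp add: norm_ell2_square col(1))
    then show ?thesis
      by (rule has_sum_cong_neutral[THEN iffD1, rotated -1]) (auto simp: g_def)
  qed
  define R where "R h = h - adj G (G h)" for h
  have GG: "(\<lambda>h. adj G (G h)) \<in> bop"
    by (rule bop_comp[OF bop_adj col(3)]) (rule col(3))
  have Rbop: "R \<in> bop"
    unfolding R_def by (rule bop_sub[OF bop_id GG])
  have R0: "R h = 0" for h
  proof (rule ccontr)
    assume "R h \<noteq> 0"
    then obtain m where m: "m \<in> M" and w: "m (R h) \<noteq> 0"
      using nondeg by blast
    have mbop: "m \<in> bop" using M m by (auto simp: ternary_def)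
    have m_bipolar: "m \<in> bipolar M" by (rule bipolar_base[OF m mbop])
    \<comment> \<open>Each \<open>m z\<^sup>* z\<close> is a triple product, hence their sum, and
      with it \<open>m R\<close>, stays in the bipolar.\<close>
    have "(\<lambda>v. m (adj G (G v))) \<in> bipolar M"
      by (rule bipolar_comp_column[OF mbop col(3) col(1) ternary_bipolar[OF M m_bipolar g_bipolar g_bipolar]])
    then have mR: "(\<lambda>v. m (R v)) \<in> bipolar M"
      unfolding R_def bop_diff[OF mbop] using m_bipolar by (rule bipolar_sub[rotated])
    obtain B where B: "B > 0" "\<And>v. norm (m v) \<le> B * norm v"
      using bop_bound[OF mbop] by blast
    define z where "z t = (\<lambda>v. complex_of_real t *\<^sub>C m (R v))" for t
    have z_nz: "z t h \<noteq> 0" if "t > 0" for t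
      using that w by (simp add: z_def scaleC_eq_0_iff)
    \<comment> \<open>All these operators are nonzero at \<open>h\<close> and pairwise distinct.
      Summability of \<open>(norm (y h))\<^sup>2\<close> over \<open>Z\<close> leaves room for only
      countably many of them, so some admissible \<open>t\<close> gives a new one.\<close>
    have "inj_on z {0<..1/B}"
    proof (rule inj_onI)
      fix s t assume "z s = z t"
      then have "s *\<^sub>R m (R h) = t *\<^sub>R m (R h)"
        unfolding z_def scaleC_of_real by (rule fun_cong)
      then show "s = t"
        using w by simp
    qed
    moreover have "uncountable {0<..1/B}"
      using B(1) by (simp add: uncountable_half_open_interval_2)
    ultimately have "uncountable (z ` {0<..1/B})"
      by (simp add: countable_image_inj_eq)
    moreover have "countable {y\<in>Z. (norm (y h))\<^sup>2 \<noteq> 0}"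
      by (rule summable_countable_real) (use G_sum[of h] in \<open>auto simp: summable_on_def\<close>)
    ultimately have "\<not> z ` {0<..1/B} \<subseteq> {y\<in>Z. (norm (y h))\<^sup>2 \<noteq> 0}"
      using countable_subset by blast
    then obtain t where "t \<in> {0<..1/B}" "z t \<notin> {y\<in>Z. (norm (y h))\<^sup>2 \<noteq> 0}"
      by blast
    then have t: "0 < t" "t \<le> 1/B" and "z t \<notin> {y\<in>Z. (norm (y h))\<^sup>2 \<noteq> 0}"
      by simp_all
    then have new: "z t \<notin> Z"
      using z_nz[OF t(1)] by simp
    have z_le: "norm (z t v) \<le> norm (R v)" for v
    proof -
      have "norm (z t v) = t * norm (m (R v))"
        using t(1) by (simp add: z_def norm_scaleC)
      also have "\<dots> \<le> t * (B * norm (R v))"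
        using t(1) B(2) by (simp add: mult_left_mono)
      also have "\<dots> = (t * B) * norm (R v)"
        by simp
      also have "\<dots> \<le> 1 * norm (R v)"
        using t B(1) by (intro mult_right_mono) (simp_all add: field_simps)
      finally show ?thesis by simp
    qed
    have "insert (z t) Z \<in> P"
      unfolding P_def
    proof (intro CollectI conjI allI impI)
      have "z t \<in> bipolar M"
        unfolding z_def by (rule bipolar_scale[OF mR])
      moreover have "z t \<noteq> (\<lambda>_. 0)"
        using z_nz[OF t(1)] by auto
      ultimately show "insert (z t) Z \<subseteq> bipolar M - {\<lambda>_. 0}"
        using Z by auto
      fix F v assume F: "F \<subseteq> insert (z t) Z" "finite F"
      have "(\<Sum>y\<in>F. (norm (y v))\<^sup>2) \<le> (\<Sum>y\<in>insert (z t) (F - {z t}). (norm (y v))\<^sup>2)"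
        using F(2) by (intro sum_mono2) auto
      also have "\<dots> = (norm (z t v))\<^sup>2 + (\<Sum>y\<in>F - {z t}. (norm (y v))\<^sup>2)"
        using F(2) by (subst sum.insert) simp_all
      also have "(norm (z t v))\<^sup>2 \<le> (norm (R v))\<^sup>2"
        by (intro power_mono z_le) simp
      also have "(\<Sum>y\<in>F - {z t}. (norm (y v))\<^sup>2) = (\<Sum>y\<in>F - {z t}. (norm (ell2_nth (G v) y))\<^sup>2)"
        using F(1) by (intro sum.cong refl) (auto simp: col(1) g_def)
      also have "\<dots> \<le> (norm (G v))\<^sup>2"
        using F(2) by (intro ell2_finite_sum_le) simp
      also have "(norm (R v))\<^sup>2 + (norm (G v))\<^sup>2 \<le> (norm v)\<^sup>2"
        unfolding R_def by (rule norm_defect_le[OF col(3) col(2)])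
      finally show "(\<Sum>y\<in>F. (norm (y v))\<^sup>2) \<le> (norm v)\<^sup>2" by simp
    qed
    then show False
      using max[of "insert (z t) Z"] new by blast
  qed
  have "((\<lambda>z. (norm (z h))\<^sup>2) has_sum (norm h)\<^sup>2) Z" for h
  proof -
    \<comment> \<open>\<open>R = 0\<close> means that \<open>adj G\<close> composed with
      \<open>G\<close> is the identity, so the column is isometric.\<close>
    have "complex_of_real ((norm (G h))\<^sup>2) = complex_of_real ((norm h)\<^sup>2)"
      using R0[of h] by (simp only: cinner_self[symmetric] cinner_adj_left[OF col(3), symmetric] R_def
          right_minus_eq)
    then show ?thesis
      using G_sum[of h] unfolding of_real_eq_iff by simp
  qed
  then show ?thesis
    using Z by blast
qed

text \<open>Label \<open>z\<close> by a vector \<open>H z\<close> at which it is nonzero, together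
  with its number in the countable set of members nonzero at that vector.\<close>

lemma summable_family_inj:
  fixes Z :: "('a::chilbert_space \<Rightarrow> 'b::chilbert_space) set"
  assumes "\<And>h. (\<lambda>z. (norm (z h))\<^sup>2) summable_on Z" "(\<lambda>_. 0) \<notin> Z"
  shows "\<exists>\<phi> :: ('a \<Rightarrow> 'b) \<Rightarrow> 'a \<times> nat. inj_on \<phi> Z"
proof -
  have "\<exists>h. z h \<noteq> 0" if "z \<in> Z" for z
    using assms(2) that by (metis ext)
  then obtain H where H: "\<And>z. z \<in> Z \<Longrightarrow> z (H z) \<noteq> 0"
    by metis
  have "countable {z\<in>Z. (norm (z h))\<^sup>2 \<noteq> 0}" for h
    by (rule summable_countable_real[OF assms(1)])
  then have inj: "inj_on (to_nat_on {z\<in>Z. (norm (z h))\<^sup>2 \<noteq> 0}) {z\<in>Z. (norm (z h))\<^sup>2 \<noteq> 0}" for h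
    by (rule inj_on_to_nat_on)
  have "inj_on (\<lambda>z. (H z, to_nat_on {y\<in>Z. (norm (y (H z)))\<^sup>2 \<noteq> 0} z)) Z"
  proof (rule inj_onI)
    fix y z assume yz: "y \<in> Z" "z \<in> Z"
      "(H y, to_nat_on {x\<in>Z. (norm (x (H y)))\<^sup>2 \<noteq> 0} y) = (H z, to_nat_on {x\<in>Z. (norm (x (H z)))\<^sup>2 \<noteq> 0} z)"
    then show "y = z"
      using inj_onD[OF inj[of "H z"], of y z] H[of y] H[of z] by auto
  qed
  then show ?thesis by blast
qed

text \<open>An infinite \<open>J\<close> satisfies \<open>J \<times> J \<cong> J\<close>, which
  folds the enlarged index set \<open>Z \<times> J\<close> back into \<open>J\<close>.\<close>

lemma inj_times_infinite:
  fixes \<phi> :: "'z \<Rightarrow> 'j"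
  assumes "infinite (UNIV :: 'j set)" "inj_on \<phi> Z"
  shows "\<exists>\<iota> :: 'z \<times> 'j \<Rightarrow> 'j. inj_on \<iota> (Z \<times> UNIV)"
proof -
  obtain p :: "'j \<times> 'j \<Rightarrow> 'j" where p: "bij_betw p (UNIV \<times> UNIV) UNIV"
    using card_of_Times_same_infinite[OF assms(1)] unfolding card_of_ordIso[symmetric] by blast
  then have p_inj: "p a = p b \<Longrightarrow> a = b" for a b
    by (simp add: bij_betw_def inj_eq)
  have "inj_on (\<lambda>(z, j). p (\<phi> z, j)) (Z \<times> UNIV)"
    by (rule inj_onI) (auto dest!: p_inj inj_onD[OF assms(2)])
  then show ?thesis
    by (intro exI[of _ "\<lambda>(z, j). p (\<phi> z, j)"])
qed

text \<open>Apply the isometric column of \<open>Z\<close> in every coordinate \<open>j\<close> and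
  store the component at \<open>(z, j)\<close> in row \<open>\<iota> (z, j)\<close>. Each row then
  has at most one nonzero entry, so it is a matrix unit or zero.\<close>

lemma isometry_in_matrix_bipolar:
  fixes M :: "('a::chilbert_space \<Rightarrow> 'b::chilbert_space) set" and \<iota> :: "('a \<Rightarrow> 'b) \<times> 'j \<Rightarrow> 'j"
  assumes M: "M \<subseteq> bop" and Z: "Z \<subseteq> bipolar M"
    and sum: "\<And>h. ((\<lambda>z. (norm (z h))\<^sup>2) has_sum (norm h)\<^sup>2) Z"
    and inj: "inj_on \<iota> (Z \<times> UNIV)"
  shows "\<exists>V\<in>bipolar (matrix_units M). \<forall>f :: ('j, 'a) ell2. norm (V f :: ('j, 'b) ell2) = norm f"
proof -
  let ?D = "Z \<times> (UNIV :: 'j set)"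
  define \<kappa> where "\<kappa> = inv_into ?D \<iota>"
  \<comment> \<open>\<open>g k\<close> is row \<open>k\<close> of the desired operator; rows outside
    the range of \<open>\<iota>\<close> are zero.\<close>
  define g where "g k = (\<lambda>f :: ('j, 'a) ell2. if k \<in> \<iota> ` ?D then fst (\<kappa> k) (ell2_nth f (snd (\<kappa> k))) else 0)" for k
  have \<kappa>: "\<kappa> (\<iota> (z, j)) = (z, j)" if "z \<in> Z" for z j
    unfolding \<kappa>_def using that by (intro inv_into_f_f[OF inj]) simp
  have fst_\<kappa>: "fst (\<kappa> k) \<in> Z" if "k \<in> \<iota> ` ?D" for k
    using that \<kappa> by auto
  have gbop: "g k \<in> bop" for k
  proof (cases "k \<in> \<iota> ` ?D")
    case True
    have "fst (\<kappa> k) \<in> bop"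
      using fst_\<kappa>[OF True] Z bipolar_bop by blast
    from bop_comp[OF this bop_nth] True show ?thesis
      by (simp add: g_def)
  qed (simp add: g_def)
  have g_sum: "((\<lambda>k. (norm (g k f))\<^sup>2) has_sum (norm f)\<^sup>2) UNIV" for f
  proof -
    let ?n = "\<lambda>(j, z). (norm (z (ell2_nth f j)))\<^sup>2"
    have inner: "((\<lambda>z. ?n (j, z)) has_sum (norm (ell2_nth f j))\<^sup>2) Z" for j
      using sum by simp
    have outer: "((\<lambda>j. (norm (ell2_nth f j))\<^sup>2) has_sum (norm f)\<^sup>2) UNIV"
      unfolding norm_ell2_square by (rule has_sum_infsum[OF ell2_summable])
    \<comment> \<open>Summing over \<open>z\<close> first uses the isometric family at each
      coordinate; summing over \<open>j\<close> then gives the norm of \<open>f\<close>.\<close>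
    have "(?n has_sum (norm f)\<^sup>2) (UNIV \<times> Z)"
      by (rule has_sum_SigmaI[OF inner outer])
        (rule summable_on_SigmaI[OF inner ell2_summable], auto)
    then have "((\<lambda>(z, j). (norm (z (ell2_nth f j)))\<^sup>2) has_sum (norm f)\<^sup>2) ?D"
      by (subst (asm) has_sum_swap) (simp add: case_prod_unfold)
    then have "(((\<lambda>k. (norm (g k f))\<^sup>2) \<circ> \<iota>) has_sum (norm f)\<^sup>2) ?D"
      by (rule has_sum_cong[THEN iffD1, rotated]) (auto simp: g_def \<kappa>)
    then have "((\<lambda>k. (norm (g k f))\<^sup>2) has_sum (norm f)\<^sup>2) (\<iota> ` ?D)"
      by (simp add: has_sum_reindex[OF inj])
    then show ?thesis
      by (rule has_sum_cong_neutral[THEN iffD1, rotated -1]) (auto simp: g_def)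
  qed
  have g_le: "(\<Sum>k\<in>F. (norm (g k f))\<^sup>2) \<le> (norm f)\<^sup>2" if "finite F" for F f
    using finite_sum_le_infsum[of "\<lambda>k. (norm (g k f))\<^sup>2" UNIV F] that g_sum[of f]
    by (auto simp: summable_on_def infsumI)
  note col = column_nth[of g, OF gbop g_le] bop_column[of g, OF gbop g_le]
  have "norm (column g f) = norm f" for f
  proof -
    have "(norm (column g f))\<^sup>2 = (norm f)\<^sup>2"
      using infsumI[OF g_sum[of f]] by (simp add: norm_ell2_square col(1))
    then show ?thesis by (simp add: power2_eq_iff_nonneg)
  qed
  moreover have "(\<lambda>v. column g v) \<in> bipolar (matrix_units M)"
  proof (rule bipolar_insert_id[OF bop_id col(2)])
    fix k
    show "(\<lambda>v. single k (ell2_nth (column g v) k)) \<in> bipolar (matrix_units M)"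
    proof (cases "k \<in> \<iota> ` ?D")
      case True
      then have "(\<lambda>v. single k (ell2_nth (column g v) k)) = matrix_unit k (snd (\<kappa> k)) (fst (\<kappa> k))"
        by (simp add: col(1) g_def matrix_unit_def)
      then show ?thesis
        using fst_\<kappa>[OF True] Z by (auto intro: matrix_unit_bipolar[OF M])
    qed (simp add: col(1) g_def bop_zero[OF bop_single] bipolar_zero)
  qed
  ultimately show ?thesis
    by (intro bexI[of _ "column g"]) auto
qed

section \<open>A unitary from two isometries\<close>

text \<open>Right multipliers of \<open>bipolar N\<close> whose adjoints are right multipliers too.
  They contain the identity and the products \<open>V\<^sup>* W\<close>, and are closed under
  composition, difference and adjoint.\<close>

definition absorbed :: "('a::chilbert_space \<Rightarrow> 'b::chilbert_space) set \<Rightarrow> ('a \<Rightarrow> 'a) \<Rightarrow> bool" where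
  "absorbed N R \<longleftrightarrow> R \<in> bop \<and>
    (\<forall>A\<in>bipolar N. (\<lambda>v. A (R v)) \<in> bipolar N \<and> (\<lambda>v. A (adj R v)) \<in> bipolar N)"

lemma
  assumes "absorbed N R" "A \<in> bipolar N"
  shows absorbedD: "(\<lambda>v. A (R v)) \<in> bipolar N" and absorbed_adjD: "(\<lambda>v. A (adj R v)) \<in> bipolar N"
  using assms by (simp_all add: absorbed_def)

lemma absorbed_comp:
  assumes P: "absorbed N P" and R: "absorbed N R" shows "absorbed N (\<lambda>v. P (R v))"
proof -
  have b: "P \<in> bop" "R \<in> bop"
    using assms by (simp_all add: absorbed_def)
  show ?thesis
    unfolding absorbed_def adj_comp[OF b]
    using absorbedD[OF R absorbedD[OF P]] absorbed_adjD[OF P absorbed_adjD[OF R]] bop_comp[OF b]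
    by simp
qed

lemma absorbed_adj: "absorbed N R \<Longrightarrow> absorbed N (adj R)"
  by (simp add: absorbed_def bop_adj adj_adj)

lemma absorbed_adj_comp:
  assumes N: "ternary N" and V: "V \<in> bipolar N" and W: "W \<in> bipolar N"
  shows "absorbed N (\<lambda>v. adj V (W v))"
  unfolding absorbed_def
proof (intro conjI ballI)
  note b = bipolar_bop[OF V] bipolar_bop[OF W]
  show "(\<lambda>v. adj V (W v)) \<in> bop"
    by (rule bop_comp[OF bop_adj b(2)]) (rule b(1))
  fix A assume A: "A \<in> bipolar N"
  show "(\<lambda>v. A (adj V (W v))) \<in> bipolar N" "(\<lambda>v. A (adj (\<lambda>v. adj V (W v)) v)) \<in> bipolar N"
    by (simp_all add: adj_comp[OF bop_adj b(2)] b adj_adj ternary_bipolar[OF N A V W] ternary_bipolar[OF N A W V])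
qed

lemma absorbed_id: "absorbed N (\<lambda>v. v)"
  by (simp add: absorbed_def adj_id)

lemma absorbed_sub:
  assumes "absorbed N P" "absorbed N R" shows "absorbed N (\<lambda>v. P v - R v)"
  using assms unfolding absorbed_def
  by (auto simp: bop_sub adj_sub bop_diff[OF bipolar_bop] intro!: bipolar_sub)

text \<open>\<open>V\<close> is used on the range of the projection \<open>P\<close>, and
  \<open>adj W\<close> on its complement, which lies in the range of \<open>W\<close>. The recursion
  \<open>P = Q + W V P S\<close> yields \<open>W\<^sup>* P W = V P V\<^sup>*\<close>, so the two
  image projections add up to the identity.\<close>

lemma unitary_from_isometries:
  fixes V :: "'a::chilbert_space \<Rightarrow> 'b::chilbert_space" and W :: "'b \<Rightarrow> 'a"
  assumes N: "ternary N" and V: "V \<in> bipolar N" and W: "adj W \<in> bipolar N" "W \<in> bop"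
    and V_iso: "\<And>x. norm (V x) = norm x" and W_iso: "\<And>y. norm (W y) = norm y"
  shows "\<exists>U\<in>bipolar N. unitary_op UNIV UNIV U"
proof -
  have Vb: "V \<in> bop" by (rule bipolar_bop[OF V])
  note Wb = W(2)
  have VV: "adj V (V x) = x" for x by (rule isometry_adj_comp[OF Vb V_iso])
  have WW: "adj W (W y) = y" for y by (rule isometry_adj_comp[OF Wb W_iso])
  \<comment> \<open>\<open>Q\<close> projects onto the complement of the range of \<open>W\<close>,
    and \<open>S\<close> is the adjoint of the isometry \<open>W V\<close>.\<close>
  define Q where "Q x = x - W (adj W x)" for x
  define S where "S x = adj V (adj W x)" for x
  have Q_abs: "absorbed N Q"
    using absorbed_sub[OF absorbed_id absorbed_adj_comp[OF N W(1) W(1)]]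
    by (simp add: Q_def[abs_def] adj_adj Wb)
  have S_abs: "absorbed N S"
    using absorbed_adj_comp[OF N V W(1)] by (simp add: S_def[abs_def])
  have Qb: "Q \<in> bop" and Sb: "S \<in> bop"
    using Q_abs S_abs by (simp_all add: absorbed_def)
  have adjQ: "adj Q = Q"
    unfolding Q_def[abs_def]
    by (simp add: adj_sub bop_comp[OF Wb bop_adj[OF Wb]] adj_id adj_comp Wb bop_adj adj_adj)
  have adjS: "adj S = (\<lambda>x. W (V x))"
    unfolding S_def[abs_def] by (simp add: adj_comp Vb Wb bop_adj adj_adj)
  note lin = bop_zero[OF Vb] bop_zero[OF Wb] bop_zero[OF bop_adj[OF Vb]] bop_zero[OF bop_adj[OF Wb]]
    bop_zero[OF Qb] bop_zero[OF Sb] bop_diff[OF Vb] bop_diff[OF Wb] bop_diff[OF bop_adj[OF Vb]] bop_diff[OF bop_adj[OF Wb]]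
    bop_diff[OF Qb] bop_diff[OF Sb] bop_add[OF Vb] bop_add[OF Wb] bop_add[OF bop_adj[OF Vb]]
    bop_add[OF bop_adj[OF Wb]] bop_add[OF Qb] bop_add[OF Sb]
  have QW: "Q (W y) = 0" for y
    by (simp add: Q_def WW)
  have QQ: "Q (Q x) = Q x" for x
    by (simp add: Q_def lin WW)
  have SQ: "S (Q x) = 0" for x
    by (simp add: Q_def S_def lin WW)
  have SD: "S (W (V x)) = x" for x
    by (simp add: S_def WW VV)
  \<comment> \<open>Since \<open>Q\<close> is a projection,
    \<open>g\<^sub>n\<^sup>* g\<^sub>n\<close> is the \<open>n\<close>-th summand of
    \<open>P\<close>; \<open>P\<close> is thus obtained from a column.\<close>
  define g where "g n = (\<lambda>x. Q ((S ^^ n) x))" for n :: nat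
  have g_Suc: "g (Suc n) x = g n (S x)" for n x
    by (simp add: g_def funpow_swap1)
  have "absorbed N (S ^^ n)" for n
    by (induction n) (simp_all add: absorbed_id id_def comp_def absorbed_comp[OF S_abs])
  then have g_abs: "absorbed N (g n)" for n
    unfolding g_def by (rule absorbed_comp[OF Q_abs])
  have gb: "g n \<in> bop" for n
    using g_abs by (simp add: absorbed_def)
  have adjW_le: "norm (adj W x) \<le> norm x" for x
    by (rule norm_adj_le[OF Wb]) (simp add: W_iso)
  have S_le: "norm (S x) \<le> norm (adj W x)" for x
    unfolding S_def by (rule norm_adj_le[OF Vb]) (simp add: V_iso)
  have Pythagoras: "(norm (Q x))\<^sup>2 + (norm (S x))\<^sup>2 \<le> (norm x)\<^sup>2" for x
  proof -
    have "(norm (S x))\<^sup>2 \<le> (norm (adj W x))\<^sup>2"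
      by (intro power_mono S_le norm_ge_zero)
    then show ?thesis
      using norm_defect_le[OF bop_adj[OF Wb] adjW_le, of x] by (simp only: Q_def adj_adj Wb)
  qed
  \<comment> \<open>\<open>Pythagoras\<close> applied along the orbit of \<open>x\<close> under
    \<open>S\<close> telescopes.\<close>
  have Bessel: "(\<Sum>n<k. (norm (g n x))\<^sup>2) + (norm ((S ^^ k) x))\<^sup>2 \<le> (norm x)\<^sup>2" for k x
  proof (induction k)
    case (Suc k)
    then show ?case
      using Pythagoras[of "(S ^^ k) x"] by (simp add: g_def)
  qed simp
  have g_le_k: "(\<Sum>n<k. (norm (g n x))\<^sup>2) \<le> (norm x)\<^sup>2" for k x
    using Bessel[of x k] zero_le_power2[of "norm ((S ^^ k) x)"] by linarith
  have g_le: "(\<Sum>n\<in>F. (norm (g n x))\<^sup>2) \<le> (norm x)\<^sup>2" if F: "finite F" for F x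
  proof -
    obtain k where "F \<subseteq> {..<k}"
      using F finite_nat_iff_bounded by blast
    then have "(\<Sum>n\<in>F. (norm (g n x))\<^sup>2) \<le> (\<Sum>n<k. (norm (g n x))\<^sup>2)"
      by (intro sum_mono2) auto
    then show ?thesis
      using g_le_k[of x k] by linarith
  qed
  define G where "G = column g"
  note col = column_nth[of g, OF gb g_le, folded G_def] bop_column[of g, OF gb g_le, folded G_def]
  define P where "P x = adj G (G x)" for x
  have Pb: "P \<in> bop"
    unfolding P_def by (rule bop_comp[OF bop_adj[OF col(2)] col(2)])
  have adjP: "adj P = P"
    unfolding P_def[abs_def] by (rule adj_self_comp[OF col(2)])
  note P_lin = bop_diff[OF Pb] bop_add[OF Pb]
  \<comment> \<open>The \<open>n = 0\<close> term is \<open>Q\<close>; by \<open>g_Suc\<close> the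
    remaining terms are the same series with \<open>S\<close> on both sides.\<close>
  have P_rec: "P x = Q x + W (V (P (S x)))" for x
  proof (rule cinner_eqI)
    fix y
    have "(\<lambda>n. cinner (g n x) (g n y)) sums cinner (G x) (G y)"
      by (rule has_sum_imp_sums[OF cinner_column_column[of G x g y, OF col(1) col(1)]])
    moreover have "(\<lambda>n. cinner (g n (S x)) (g n (S y))) sums cinner (G (S x)) (G (S y))"
      by (rule has_sum_imp_sums[OF cinner_column_column[of G "S x" g "S y", OF col(1) col(1)]])
    then have "(\<lambda>n. cinner (g n x) (g n y)) sums (cinner (G (S x)) (G (S y)) + cinner (g 0 x) (g 0 y))"
      unfolding g_Suc[symmetric] by (rule sums_Suc)
    ultimately have "cinner (G x) (G y) = cinner (G (S x)) (G (S y)) + cinner (Q x) (Q y)"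
      by (simp add: sums_unique2 g_def)
    moreover have "cinner (Q x) (Q y) = cinner (Q x) y"
      using cinner_adj_right[OF Qb, of "Q x" y] by (simp add: adjQ QQ)
    moreover have "cinner (G (S x)) (G (S y)) = cinner (W (V (P (S x)))) y"
      using cinner_adj_left[OF Sb, of "P (S x)" y]
      by (simp add: adjS P_def cinner_adj_left[OF col(2)])
    moreover have "cinner (G x) (G y) = cinner (P x) y"
      by (simp add: P_def cinner_adj_left[OF col(2)])
    ultimately show "cinner (P x) y = cinner (Q x + W (V (P (S x)))) y"
      by (simp add: cinner_add_left)
  qed
  have QP: "Q (P x) = Q x" for x
    by (subst P_rec) (simp add: lin QW QQ)
  have SP: "S (P x) = P (S x)" for x
    by (subst P_rec) (simp add: lin SQ SD)
  have PD: "P (W (V x)) = W (V (P x))" for x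
    by (subst P_rec) (simp add: QW SD)
  \<comment> \<open>Idempotence comes from \<open>G P = G\<close>: each \<open>g n\<close> is
    unchanged by \<open>P\<close>, because \<open>P\<close> commutes with \<open>S\<close> and
    \<open>Q P = Q\<close>.\<close>
  have "(S ^^ n) (P x) = P ((S ^^ n) x)" for n x
    by (induction n) (simp_all add: SP)
  then have "g n (P x) = g n x" for n x
    by (simp add: g_def QP)
  then have "G (P x) = G x" for x
    by (intro ell2_eqI) (simp add: col(1))
  then have PP: "P (P x) = P x" for x
    by (simp add: P_def)
  define U where "U x = V (P x) + adj W (x - P x)" for x
  \<comment> \<open>Right multiplication by the infinite sum \<open>P\<close> is handled termwise,
    each summand being absorbed.\<close>
  have AP: "(\<lambda>x. A (P x)) \<in> bipolar N" if A: "A \<in> bipolar N" for A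
    unfolding P_def
  proof (rule bipolar_comp_column[OF bipolar_bop[OF A] col(2) col(1)])
    fix n
    show "(\<lambda>v. A (adj (g n) (g n v))) \<in> bipolar N"
      by (rule absorbedD[OF absorbed_comp[OF absorbed_adj[OF g_abs] g_abs] A])
  qed
  have U_bipolar: "U \<in> bipolar N"
    unfolding U_def[abs_def] lin by (intro bipolar_plus bipolar_sub AP V W(1))
  have adjU: "adj U = (\<lambda>y. P (adj V y) + (W y - P (W y)))"
  proof -
    have b: "(\<lambda>x. x - P x) \<in> bop"
      by (rule bop_sub[OF bop_id Pb])
    show ?thesis
      unfolding U_def[abs_def] adj_plus[OF bop_comp[OF Vb Pb] bop_comp[OF bop_adj[OF Wb] b]]
        adj_comp[OF Vb Pb] adj_comp[OF bop_adj[OF Wb] b] adj_sub[OF bop_id Pb] adj_id adjP adj_adj[OF Wb]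
      by (rule refl)
  qed
  have "adj U (U x) = x" for x
  proof -
    \<comment> \<open>The part of \<open>x\<close> off the range of \<open>P\<close> is killed by
      \<open>Q\<close>, hence lies in the range of \<open>W\<close>, where \<open>W\<close> inverts
      \<open>adj W\<close>.\<close>
    define u where "u = x - P x"
    have Pu: "P u = 0" and Qu: "Q u = 0"
      by (simp_all add: u_def P_lin PP lin QP)
    have WWu: "W (adj W u) = u"
      using Qu by (simp add: Q_def)
    have "P (adj V (adj W u)) = 0"
      using SP[of u] Pu bop_zero[OF Sb] by (simp add: S_def)
    then have "P (adj V (U x)) = P x"
      by (simp add: U_def u_def[symmetric] lin P_lin VV PP)
    moreover have "W (U x) = W (V (P x)) + u"
      by (simp add: U_def u_def[symmetric] lin WWu)
    ultimately show ?thesis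
      by (simp add: adjU P_lin PD PP Pu) (simp add: u_def)
  qed
  moreover have "U (adj U y) = y" for y
  proof -
    have "P (adj U y) = P (adj V y)"
      by (simp add: adjU P_lin PP)
    then have "U (adj U y) = V (P (adj V y)) + (y - adj W (P (W y)))"
      by (simp add: U_def) (simp add: adjU lin WW)
    \<comment> \<open>Expanding \<open>P\<close> at \<open>W y\<close> by its recursion kills the
      \<open>Q\<close> term and cancels \<open>W\<close> against \<open>adj W\<close>.\<close>
    also have "adj W (P (W y)) = V (P (adj V y))"
      by (subst P_rec) (simp add: QW WW S_def)
    finally show ?thesis by simp
  qed
  ultimately show ?thesis
    using U_bipolar bipolar_bop[OF U_bipolar] unfolding unitary_op_UNIV_iff by blast
qed

section \<open>From the TRO to the unitary equivalence of amplifications\<close>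

lemma tro_ternary:
  assumes "tro UNIV UNIV M" shows "ternary M"
proof -
  have M: "M \<subseteq> bop"
    using assms by (simp add: tro_def op_subspace_def)
  have "(\<lambda>v. l (adj m (n v))) \<in> M" if "l \<in> M" "m \<in> M" "n \<in> M" for l m n
    using assms that unfolding tro_def compose_UNIV by blast
  then show ?thesis
    using M unfolding ternary_def by (blast intro: bipolar_base)
qed

text \<open>The adjoint of \<open>n m\<^sup>* l\<close> is \<open>l\<^sup>* m n\<^sup>*\<close>, the
  triple product of the adjoints.\<close>

lemma ternary_adj_image:
  assumes M: "ternary M" shows "ternary (adj ` M)"
proof -
  have Mb: "M \<subseteq> bop" using M by (simp add: ternary_def)
  have "(\<lambda>v. adj l (adj (adj m) (adj n v))) \<in> bipolar (adj ` M)" if lmn: "l \<in> M" "m \<in> M" "n \<in> M" for l m n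
  proof -
    have b: "l \<in> bop" "m \<in> bop" "n \<in> bop" using Mb lmn by auto
    have "(\<lambda>v. n (adj m (l v))) \<in> bipolar M"
      using M lmn by (simp add: ternary_def)
    then have "adj (\<lambda>v. n (adj m (l v))) \<in> bipolar (adj ` M)"
      by (rule bipolar_adj_image[OF Mb])
    then show ?thesis
      by (simp add: adj_comp[OF b(3) bop_comp[OF bop_adj[OF b(2)] b(1)]]
          adj_comp[OF bop_adj[OF b(2)] b(1)])
  qed
  then show ?thesis
    using adj_image_bop[OF Mb] unfolding ternary_def by blast
qed

lemma adj_matrix_units: "X \<subseteq> bop \<Longrightarrow> A \<in> matrix_units (adj ` X) \<Longrightarrow> adj A \<in> matrix_units X"
  unfolding matrix_units_def by (fastforce simp: adj_matrix_unit adj_adj bop_adj)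

lemma adj_image_matrix_units:
  fixes X :: "('a::chilbert_space \<Rightarrow> 'b::chilbert_space) set"
  assumes "X \<subseteq> bop"
  shows "adj ` (matrix_units X :: (('j, 'a) ell2 \<Rightarrow> ('i, 'b) ell2) set) \<subseteq> matrix_units (adj ` X)"
proof
  fix B assume "B \<in> adj ` (matrix_units X :: (('j, 'a) ell2 \<Rightarrow> ('i, 'b) ell2) set)"
  then obtain i j s where "B = adj (matrix_unit i j s)" "s \<in> X"
    unfolding matrix_units_def by blast
  then have "B = matrix_unit j i (adj s)" "adj s \<in> adj ` X"
    using adj_matrix_unit[OF subsetD[OF assms], of s i j] by simp_all
  then show "B \<in> matrix_units (adj ` X)"
    unfolding matrix_units_def by blast
qed

text \<open>The vector functional of \<open>k\<close> is normal and vanishes on \<open>X\<close>,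
  hence also at the identity, where its value is the squared norm of \<open>k\<close>.\<close>

lemma id_bipolar_separating:
  assumes "(\<lambda>x. x) \<in> bipolar X" "X \<subseteq> bop" "\<And>B. B \<in> X \<Longrightarrow> B k = 0"
  shows "k = 0"
proof -
  have normal_fn: "normal_fn (single 0 k) (single 0 k) A = cinner (A k) k" if "A \<in> bop" for A
    using that by (simp add: normal_fn_def cinner_single_right map_ell2_nth single_nth)
  have "normal_fn (single 0 k) (single 0 k) B = 0" if "B \<in> X" for B
    using normal_fn[of B] assms(3)[OF that] subsetD[OF assms(2) that] by simp
  then have "normal_fn (single 0 k) (single 0 k) (\<lambda>x. x) = 0"
    using assms(1) by (simp add: bipolar_def)
  then show ?thesis
    by (simp add: normal_fn cinner_self)
qed

lemma isometry_from_ternary: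
  fixes M :: "('a::chilbert_space \<Rightarrow> 'b::chilbert_space) set" and e :: "'a \<times> nat \<Rightarrow> 'j"
  assumes M: "ternary M" and nondeg: "\<And>h. h \<noteq> 0 \<Longrightarrow> \<exists>m\<in>M. m h \<noteq> 0"
    and J: "infinite (UNIV :: 'j set)" and e: "inj e"
  shows "\<exists>V\<in>bipolar (matrix_units M). \<forall>f :: ('j, 'a) ell2. norm (V f :: ('j, 'b) ell2) = norm f"
proof -
  obtain Z where Z: "Z \<subseteq> bipolar M" "(\<lambda>_. 0) \<notin> Z"
    and sum: "\<And>h. ((\<lambda>z. (norm (z h))\<^sup>2) has_sum (norm h)\<^sup>2) Z"
    using isometric_family_exists[OF M nondeg] by blast
  obtain \<phi> :: "('a \<Rightarrow> 'b) \<Rightarrow> 'a \<times> nat" where "inj_on \<phi> Z"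
    using summable_family_inj[of Z] sum Z(2) by (auto simp: summable_on_def)
  then have "inj_on (e \<circ> \<phi>) Z"
    by (rule comp_inj_on) (rule inj_on_subset[OF e subset_UNIV])
  from inj_times_infinite[OF J this] obtain \<iota> :: "('a \<Rightarrow> 'b) \<times> 'j \<Rightarrow> 'j" where
    "inj_on \<iota> (Z \<times> UNIV)"
    by blast
  then show ?thesis
    using isometry_in_matrix_bipolar[OF _ Z(1) sum] M by (simp add: ternary_def)
qed

theorem theorem4p8:
  fixes S :: "('a::chilbert_space \<Rightarrow> 'a) set"
    and T :: "('b::chilbert_space \<Rightarrow> 'b) set"
  assumes "dual_operator_system UNIV S"
    and "dual_operator_system UNIV T"
    and "tro_equivalent UNIV UNIV S T"
  shows "\<exists>J :: ('a \<times> 'b \<times> nat) set. J \<noteq> {} \<and>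
    (\<exists>U. unitary_op (ell2_on J :: ('a \<times> 'b \<times> nat, 'a) ell2 set) (ell2_on J :: ('a \<times> 'b \<times> nat, 'b) ell2 set) U \<and>
      amplification T J =
        {compose (ell2_on J) U (compose (ell2_on J) A (adjoint_op (ell2_on J) (ell2_on J) U))
          |A. A \<in> amplification S J})"
proof -
  have S: "op_subspace UNIV UNIV S" "(\<lambda>x. x) \<in> S" and T: "op_subspace UNIV UNIV T" "(\<lambda>x. x) \<in> T"
    using assms(1,2) by (simp_all add: dual_operator_system_def operator_system_def restrict_UNIV)
  then have Sb: "S \<subseteq> bop" and Tb: "T \<subseteq> bop"
    by (simp_all add: op_subspace_def)
  obtain M where tro: "tro UNIV UNIV M"
    and T_eq: "wstar_span UNIV {(\<lambda>v. m (s (adj n v))) |m s n. m \<in> M \<and> s \<in> S \<and> n \<in> M} = T"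
    and S_eq: "wstar_span UNIV {(\<lambda>v. adj m (t (n v))) |m t n. m \<in> M \<and> t \<in> T \<and> n \<in> M} = S"
    using assms(3) unfolding tro_equivalent_def compose_UNIV by blast
  have M: "ternary M" by (rule tro_ternary[OF tro])
  then have Mb: "M \<subseteq> bop" by (simp add: ternary_def)
  let ?X = "{(\<lambda>v. m (s (adj n v))) |m s n. m \<in> M \<and> s \<in> S \<and> n \<in> M}"
  let ?Y = "{(\<lambda>v. adj m (t (n v))) |m t n. m \<in> M \<and> t \<in> T \<and> n \<in> M}"
  have Xb: "?X \<subseteq> bop"
  proof
    fix A assume "A \<in> ?X"
    then obtain m s n where A: "A = (\<lambda>v. m (s (adj n v)))" and "m \<in> M" "s \<in> S" "n \<in> M"
      by (elim CollectE exE conjE) (rule that)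
    then have "m \<in> bop" "s \<in> bop" "n \<in> bop"
      using Mb Sb by blast+
    then show "A \<in> bop"
      unfolding A by (intro bop_comp[of m "\<lambda>v. s (adj n v)"] bop_comp[of s "adj n"] bop_adj)
  qed
  have Yb: "?Y \<subseteq> bop"
  proof
    fix A assume "A \<in> ?Y"
    then obtain m t n where A: "A = (\<lambda>v. adj m (t (n v)))" and "m \<in> M" "t \<in> T" "n \<in> M"
      by (elim CollectE exE conjE) (rule that)
    then have "m \<in> bop" "t \<in> bop" "n \<in> bop"
      using Mb Tb by blast+
    then show "A \<in> bop"
      unfolding A by (intro bop_comp[of "adj m" "\<lambda>v. t (n v)"] bop_comp[of t n] bop_adj)
  qed
  have TX: "T = bipolar ?X" and SY: "S = bipolar ?Y"
    using T_eq S_eq by (simp_all add: wstar_span_eq_bipolar Xb Yb)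
  have XT: "A \<in> T" if "A \<in> ?X" for A
    by (subst TX) (rule bipolar_base[OF that subsetD[OF Xb that]])
  have YS: "A \<in> S" if "A \<in> ?Y" for A
    by (subst SY) (rule bipolar_base[OF that subsetD[OF Yb that]])
  \<comment> \<open>A vector killed by all of \<open>M\<close> is killed by every generator
    \<open>m\<^sup>* t n\<close> of \<open>S\<close>, which contradicts the unit of
    \<open>S\<close>. The unit of \<open>T\<close> gives the same for the adjoints.\<close>
  have nondeg: "\<exists>m\<in>M. m h \<noteq> 0" if "h \<noteq> 0" for h
  proof (rule ccontr)
    assume "\<not> (\<exists>m\<in>M. m h \<noteq> 0)"
    then have "B h = 0" if "B \<in> ?Y" for B
      using that Mb Tb by (auto simp: subset_iff bop_zero bop_adj)
    then have "h = 0"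
      by (rule id_bipolar_separating[OF S(2)[unfolded SY] Yb])
    with that show False ..
  qed
  have nondeg': "\<exists>m\<in>adj ` M. m k \<noteq> 0" if "k \<noteq> 0" for k
  proof (rule ccontr)
    assume "\<not> (\<exists>m\<in>adj ` M. m k \<noteq> 0)"
    then have "B k = 0" if "B \<in> ?X" for B
      using that Mb Sb by (auto simp: subset_iff bop_zero)
    then have "k = 0"
      by (rule id_bipolar_separating[OF T(2)[unfolded TX] Xb])
    with that show False ..
  qed
  have J: "infinite (UNIV :: ('a \<times> 'b \<times> nat) set)"
    by (simp add: finite_prod)
  \<comment> \<open>The family for \<open>M\<close> is labelled by \<open>H \<times> nat\<close>; a
    constant in the \<open>K\<close> slot embeds these labels in \<open>J\<close>. For
    \<open>W\<close> the constant sits in the \<open>H\<close> slot.\<close>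
  obtain V :: "('a \<times> 'b \<times> nat, 'a) ell2 \<Rightarrow> ('a \<times> 'b \<times> nat, 'b) ell2" where
    V: "V \<in> bipolar (matrix_units M)" "\<And>f. norm (V f) = norm f"
    using isometry_from_ternary[OF M nondeg J, of "\<lambda>(h, n). (h, undefined, n)"]
    by (auto simp: inj_on_def)
  obtain W :: "('a \<times> 'b \<times> nat, 'b) ell2 \<Rightarrow> ('a \<times> 'b \<times> nat, 'a) ell2" where
    W: "W \<in> bipolar (matrix_units (adj ` M))" "\<And>f. norm (W f) = norm f"
    using isometry_from_ternary[OF ternary_adj_image[OF M] nondeg' J, of "\<lambda>(k, n). (undefined, k, n)"]
    by (auto simp: inj_on_def)
  let ?N = "matrix_units M :: (('a \<times> 'b \<times> nat, 'a) ell2 \<Rightarrow> ('a \<times> 'b \<times> nat, 'b) ell2) set"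
  have Nb: "?N \<subseteq> bop" by (rule matrix_units_bop[OF Mb])
  have adjN: "adj ` ?N \<subseteq> matrix_units (adj ` M)"
    by (rule adj_image_matrix_units[OF Mb])
  have "adj W \<in> bipolar ?N"
    by (rule bipolar_adj[OF W(1) matrix_units_bop[OF adj_image_bop[OF Mb]]])
      (intro bipolar_base bop_adj adj_matrix_units[OF Mb],
        auto intro: matrix_units_bop[OF adj_image_bop[OF Mb], THEN subsetD])
  then obtain U where U: "U \<in> bipolar ?N" and unitary: "unitary_op UNIV UNIV U"
    using unitary_from_isometries[OF ternary_matrix_units[OF M] V(1) _ bipolar_bop[OF W(1)] V(2) W(2)]
    by blast
  have adjU: "adj U \<in> bipolar (adj ` ?N)"
    by (rule bipolar_adj_image[OF Nb U])
  have UU: "adj U (U x) = x" "U (adj U y) = y" for x y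
    using unitary by (auto simp: unitary_op_UNIV_iff)
  \<comment> \<open>By \<open>matrix_unit_triple\<close> only entries \<open>l s n\<^sup>*\<close>
    with \<open>l\<close>, \<open>n\<close> in \<open>M\<close> have to be considered, and these are
    generators of \<open>T\<close>.\<close>
  have fwd: "(\<lambda>v. U (A (adj U v))) \<in> bipolar (matrix_units T)" if A: "A \<in> bipolar (matrix_units S)" for A
  proof (rule bipolar_triple[OF Nb matrix_units_bop[OF Sb] adj_image_bop[OF Nb] U A adjU])
    fix l m n assume "l \<in> ?N" "m \<in> (matrix_units S :: (('a \<times> 'b \<times> nat, 'a) ell2 \<Rightarrow> ('a \<times> 'b \<times> nat, 'a) ell2) set)"
      and "n \<in> adj ` ?N"
    moreover from this(3) have "n \<in> matrix_units (adj ` M)" using adjN by blast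
    ultimately obtain i j l' k p s r q n' where eq: "l = matrix_unit i j l'" "m = matrix_unit k p s"
      "n = matrix_unit r q (adj n')" and mem: "l' \<in> M" "s \<in> S" "n' \<in> M"
      unfolding matrix_units_def by blast
    have "(\<lambda>v. l' (s (adj n' v))) \<in> ?X" using mem by blast
    then have "(\<lambda>v. l' (s (adj n' v))) \<in> bipolar T"
      by (intro bipolar_base XT subsetD[OF Tb])
    then show "(\<lambda>v. l (m (n v))) \<in> bipolar (matrix_units T)"
      unfolding eq using mem Mb Sb Tb by (intro matrix_unit_triple bop_adj) auto
  qed
  have bwd: "(\<lambda>v. adj U (A (U v))) \<in> bipolar (matrix_units S)" if A: "A \<in> bipolar (matrix_units T)" for A
  proof (rule bipolar_triple[OF adj_image_bop[OF Nb] matrix_units_bop[OF Tb] Nb adjU A U])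
    fix l m n assume "l \<in> adj ` ?N" "m \<in> (matrix_units T :: (('a \<times> 'b \<times> nat, 'b) ell2 \<Rightarrow> ('a \<times> 'b \<times> nat, 'b) ell2) set)"
      and "n \<in> ?N"
    moreover from this(1) have "l \<in> matrix_units (adj ` M)" using adjN by blast
    ultimately obtain i j l' k p t r q n' where eq: "l = matrix_unit i j (adj l')" "m = matrix_unit k p t"
      "n = matrix_unit r q n'" and mem: "l' \<in> M" "t \<in> T" "n' \<in> M"
      unfolding matrix_units_def by blast
    have "(\<lambda>v. adj l' (t (n' v))) \<in> ?Y" using mem by blast
    then have "(\<lambda>v. adj l' (t (n' v))) \<in> bipolar S"
      by (intro bipolar_base YS subsetD[OF Sb])
    then show "(\<lambda>v. l (m (n v))) \<in> bipolar (matrix_units S)"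
      unfolding eq using mem Mb Sb Tb by (intro matrix_unit_triple bop_adj) auto
  qed
  have "amplification T (UNIV :: ('a \<times> 'b \<times> nat) set)
      = {\<lambda>v. U (A (adj U v)) |A. A \<in> amplification S UNIV}"
    unfolding amplification_UNIV[OF S(1)] amplification_UNIV[OF T(1)]
  \<comment> \<open>Conjugation by \<open>U\<close> maps one amplification into the other by
    \<open>fwd\<close>; by \<open>bwd\<close> each \<open>B\<close> is hit by its own conjugate
    under \<open>adj U\<close>.\<close>
  proof (intro subset_antisym subsetI)
    fix B :: "('a \<times> 'b \<times> nat, 'b) ell2 \<Rightarrow> ('a \<times> 'b \<times> nat, 'b) ell2"
    assume "B \<in> bipolar (matrix_units T)"
    then have "(\<lambda>v. adj U (B (U v))) \<in> bipolar (matrix_units S)" by (rule bwd)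
    moreover have "B = (\<lambda>v. U (adj U (B (U (adj U v)))))"
      by (simp add: UU)
    ultimately show "B \<in> {\<lambda>v. U (A (adj U v)) |A. A \<in> bipolar (matrix_units S)}"
      by (intro CollectI exI[of _ "\<lambda>v. adj U (B (U v))"]) simp
  qed (use fwd in blast)
  then show ?thesis
    using unitary by (intro exI[of _ UNIV] conjI exI[of _ U]) (simp_all add: compose_UNIV)
qed

end
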